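(* Let $\{D_1,\dots,D_m\}$ be a nontrivial $(v,m,k,\lambda)$-SEDF in a finite abelian group $G$ with $m>2$, having the simple character value property with respect to $(a,b)$, and let $p$ be a prime divisor of $v$; let $G_p$ be the Sylow $p$-subgroup of $G$. Then either both of the following hold: (1a) $|G_p|$ divides $km$; (1b) $k^2+(|G_p|-1)\lambda=|G_p|r_1$ for some integer $r_1\ge k$; or all of the following hold: (2a) $k^2m^2+(p-1)\frac{4a^2\lambda}{b^2-a^2}=pr_2$ for some integer $r_2\ge km$; (2b) $k^2+(p-1)\frac{(b-a)\lambda}{b+a}=pr_3$ for some integer $r_3\ge k$; (2c) $k^2+(p-1)\frac{(b+a)\lambda}{b-a}=pr_4$ for some integer $r_4$.
   Context: Groups are finite abelian, written multiplicatively with identity $1$. For a subset $A\subseteq G$ we also write $A$ for $\sum_{a\in A}a\in\mathbb{Z}[G]$ and $A^{(-1)}=\sum_{a\in A}a^{-1}$. Given integers $m\ge 2$, $k\ge1$, $\lambda\ge 1$ and a group $G$ of order $v$, mutually disjoint $k$-subsets $D_1,\dots,D_m$ form a $(v,m,k,\lambda)$-SEDF in $G$ if $D_j\sum_{i\ne j}D_i^{(-1)}=\lambda(G-1)$ in $\mathbb{Z}[G]$ for each $j$; nontrivial means $k>1$. $\widehat{G}$ is the character group, characters extended linearly to $\mathbb{Z}[G]$. With $D=\bigcup_iD_i$, $\widehat{G}^N$ is the set of nonprincipal $\chi$ with $\chi(D)\ne0$. For a nontrivial SEDF with $m>2$ and $\chi\in\widehat{G}^N$, $\sqrt{1+4\lambda/|\chi(D)|^2}$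 is rational; write it $b_\chi/a_\chi$ with integers $b_\chi>a_\chi>0$, $\gcd(a_\chi,b_\chi)=1$. The SEDF has the simple character value property with respect to $(a,b)$ if $(a_\chi,b_\chi)=(a,b)$ for all $\chi\in\widehat{G}^N$. *)

theory Defs
  imports Complex_Main "HOL-Algebra.Algebra" "HOL-Computational_Algebra.Primes"
begin

section \<open>The integral group ring\<close>

text \<open>
  An element of \<open>\<int>[G]\<close> is represented by its coefficient function, which vanishes outside
  \<open>carrier G\<close>. Addition and integer multiples are taken pointwise.
\<close>

type_synonym 'a group_ring = "'a \<Rightarrow> int"

definition gr_set :: "'a set \<Rightarrow> 'a group_ring" where
  "gr_set A = (\<lambda>x. if x \<in> A then 1 else 0)"

definition gr_mult :: "('a, 'b) monoid_scheme \<Rightarrow> 'a group_ring \<Rightarrow> 'a group_ring \<Rightarrow> 'a group_ring" where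
  "gr_mult G x y = (\<lambda>g. if g \<in> carrier G
     then (\<Sum>h\<in>carrier G. x h * y (inv\<^bsub>G\<^esub> h \<otimes>\<^bsub>G\<^esub> g)) else 0)"

section \<open>Strong external difference families\<close>

text \<open>
  The family \<open>D\<^sub>1, \<dots>, D\<^sub>m\<close> is a function on the naturals of which only the values at
  \<open>1, \<dots>, m\<close> matter. Inversion is injective on \<open>G\<close>, so \<open>A\<^sup>(\<^sup>-\<^sup>1\<^sup>)\<close> is the group ring element of
  the image of \<open>A\<close> under inversion.
\<close>

definition is_SEDF ::
  "('a, 'b) monoid_scheme \<Rightarrow> nat \<Rightarrow> nat \<Rightarrow> nat \<Rightarrow> nat \<Rightarrow> (nat \<Rightarrow> 'a set) \<Rightarrow> bool" where
  "is_SEDF G v m k l D \<longleftrightarrow>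
     order G = v \<and> m \<ge> 2 \<and> k \<ge> 1 \<and> l \<ge> 1 \<and>
     (\<forall>i\<in>{1..m}. D i \<subseteq> carrier G \<and> card (D i) = k) \<and>
     disjoint_family_on D {1..m} \<and>
     (\<forall>j\<in>{1..m}.
        gr_mult G (gr_set (D j)) (\<lambda>g. \<Sum>i\<in>{1..m} - {j}. gr_set (m_inv G ` D i) g)
        = (\<lambda>g. int l * (gr_set (carrier G) g - gr_set {\<one>\<^bsub>G\<^esub>} g)))"

section \<open>Characters\<close>

definition complex_mult_group :: "complex monoid" where
  "complex_mult_group = \<lparr>carrier = UNIV - {0}, monoid.mult = (*), one = 1\<rparr>"

text \<open>Extensionality makes each character of \<open>G\<close> correspond to exactly one function.\<close>

definition characters :: "('a, 'b) monoid_scheme \<Rightarrow> ('a \<Rightarrow> complex) set" where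
  "characters G = hom G complex_mult_group \<inter> extensional (carrier G)"

definition principal_character :: "('a, 'b) monoid_scheme \<Rightarrow> 'a \<Rightarrow> complex" where
  "principal_character G = (\<lambda>g\<in>carrier G. 1)"

definition char_ext :: "('a, 'b) monoid_scheme \<Rightarrow> ('a \<Rightarrow> complex) \<Rightarrow> 'a group_ring \<Rightarrow> complex" where
  "char_ext G \<chi> x = (\<Sum>g\<in>carrier G. of_int (x g) * \<chi> g)"

text \<open>The set \<open>\<widehat>G\<^sup>N\<close>, where \<open>U\<close> is the union of the family.\<close>

definition nonvanishing_characters ::
  "('a, 'b) monoid_scheme \<Rightarrow> 'a set \<Rightarrow> ('a \<Rightarrow> complex) set" where
  "nonvanishing_characters G U =
     {\<chi> \<in> characters G. \<chi> \<noteq> principal_character G \<and> char_ext G \<chi> (gr_set U) \<noteq> 0}"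

text \<open>
  \<open>char_value_pair G l U \<chi> a b\<close> says that \<open>(a, b) = (a\<^sub>\<chi>, b\<^sub>\<chi>)\<close>; at most one pair satisfies it,
  since a reduced fraction is unique.
\<close>

definition char_value_pair ::
  "('a, 'b) monoid_scheme \<Rightarrow> nat \<Rightarrow> 'a set \<Rightarrow> ('a \<Rightarrow> complex) \<Rightarrow> int \<Rightarrow> int \<Rightarrow> bool" where
  "char_value_pair G l U \<chi> a b \<longleftrightarrow>
     0 < a \<and> a < b \<and> gcd a b = 1 \<and>
     sqrt (1 + 4 * real l / (cmod (char_ext G \<chi> (gr_set U)))\<^sup>2) = real_of_int b / real_of_int a"

definition simple_character_value_property ::
  "('a, 'b) monoid_scheme \<Rightarrow> nat \<Rightarrow> nat \<Rightarrow> (nat \<Rightarrow> 'a set) \<Rightarrow> int \<Rightarrow> int \<Rightarrow> bool" where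
  "simple_character_value_property G m l D a b \<longleftrightarrow>
     (\<forall>\<chi>\<in>nonvanishing_characters G (\<Union>i\<in>{1..m}. D i).
        char_value_pair G l (\<Union>i\<in>{1..m}. D i) \<chi> a b)"

section \<open>Sylow subgroups\<close>

definition sylow_subgroup :: "('a, 'b) monoid_scheme \<Rightarrow> nat \<Rightarrow> 'a set \<Rightarrow> bool" where
  "sylow_subgroup G p H \<longleftrightarrow> subgroup H G \<and> card H = p ^ multiplicity p (order G)"

end

theory Submission
  imports Defs "HOL-Computational_Algebra.Polynomial_Factorial"
begin

text \<open>
  Applying a nonprincipal character \<open>\<chi>\<close> to the defining equations gives
  \<open>\<chi>(D\<^sub>j) cnj (\<chi>(D) - \<chi>(D\<^sub>j)) = -\<lambda>\<close>. Hence \<open>|\<chi>(D\<^sub>j)|\<^sup>2 = \<lambda>\<close> if \<open>\<chi>(D) = 0\<close>, and otherwise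
  \<open>|\<chi>(D)|\<^sup>2 = 4a\<^sup>2\<lambda>/(b\<^sup>2 - a\<^sup>2)\<close> and \<open>\<chi>(D\<^sub>j) = (a \<plusminus> b)/(2a) \<chi>(D)\<close>, with both signs occurring.

  If all nonprincipal characters of \<open>p\<close>-power order vanish on \<open>D\<close>, then (1a) and (1b) are orthogonality
  and Parseval's identity for the characters factoring through \<open>G \<rightarrow> G\<^sub>p\<close>.

  Otherwise fix such a \<open>\<chi>\<close> of order \<open>q = p\<^sup>n\<^sup>+\<^sup>1\<close> with \<open>\<chi>(D) \<noteq> 0\<close>. For \<open>A\<close> among \<open>D\<close> and the \<open>D\<^sub>j\<close>, the
  rational number \<open>N = |\<chi>(A)|\<^sup>2\<close> is unchanged if \<open>\<chi>\<close> is replaced by a Galois conjugate \<open>\<chi>\<^sup>t\<close>, where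
  \<open>t\<close> is prime to \<open>p\<close>. Roots of unity of order \<open>q\<close> are \<open>1\<close> modulo the prime above \<open>p\<close>, so that \<open>N\<close> is an
  integer with \<open>N \<equiv> |A|\<^sup>2\<close> modulo \<open>p\<close> and \<open>|A|\<^sup>2 + (p - 1)N = pr\<close> for an integer \<open>r\<close>. Comparing Parseval's
  identities for the powers of \<open>\<chi>\<close> and of \<open>\<chi>\<^sup>p\<close> gives \<open>(p - 1)N = pE - E'\<close>, where \<open>E \<ge> |A|\<close> and
  \<open>E' \<le> |A|\<^sup>2\<close> count the pairs in \<open>A\<close> on which \<open>\<chi>\<close>, respectively \<open>\<chi>\<^sup>p\<close>, agree; hence \<open>r \<ge> |A|\<close>.
\<close>

section \<open>Cyclotomic polynomials of prime power order\<close>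

lemma eisenstein_one_sided:
  fixes f g :: "int poly" and p :: int
  assumes p: "prime_elem p"
    and low: "\<And>i. i < degree (f * g) \<Longrightarrow> p dvd coeff (f * g) i"
    and lead: "\<not> p dvd lead_coeff (f * g)"
    and f0: "p dvd coeff f 0" and g0: "\<not> p dvd coeff g 0"
  shows "degree g = 0"
proof -
  have nz: "f \<noteq> 0" "g \<noteq> 0" using lead by auto
  have "\<not> p dvd lead_coeff f"
    using lead by (auto simp: lead_coeff_mult)
  \<comment> \<open>Index of the first coefficient of \<open>f\<close> that \<open>p\<close> does
    not divide. In coefficient \<open>i\<close> of \<open>f * g\<close> only the term
    \<open>coeff f i * coeff g 0\<close> escapes divisibility by \<open>p\<close>, so
    \<open>i\<close> reaches the degree of the product and \<open>g\<close> is constant.\<close>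
  define i where "i = (LEAST i. \<not> p dvd coeff f i)"
  have i: "\<not> p dvd coeff f i" and i_le: "i \<le> degree f"
    unfolding i_def using LeastI[of "\<lambda>i. \<not> p dvd coeff f i", OF \<open>\<not> p dvd lead_coeff f\<close>]
      Least_le[of "\<lambda>i. \<not> p dvd coeff f i", OF \<open>\<not> p dvd lead_coeff f\<close>] by auto
  have below: "p dvd coeff f j" if "j < i" for j
    using not_less_Least[of j] that unfolding i_def by auto
  have "coeff (f * g) i = (\<Sum>j\<le>i. coeff f j * coeff g (i - j))"
    by (simp add: coeff_mult)
  also have "\<dots> = coeff f i * coeff g 0 + (\<Sum>j<i. coeff f j * coeff g (i - j))"
    by (simp add: lessThan_Suc_atMost [symmetric])
  finally have eq: "coeff (f * g) i = coeff f i * coeff g 0 + (\<Sum>j<i. coeff f j * coeff g (i - j))" .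
  have "p dvd (\<Sum>j<i. coeff f j * coeff g (i - j))"
    by (intro dvd_sum) (auto intro: below dvd_mult2)
  moreover have "\<not> p dvd coeff f i * coeff g 0"
    using i g0 p by (simp add: prime_elem_dvd_mult_iff)
  ultimately have "\<not> p dvd coeff (f * g) i"
    unfolding eq by (simp add: dvd_add_left_iff)
  then have "degree (f * g) \<le> i" using low by (meson not_le)
  with i_le nz show ?thesis by (simp add: degree_mult_eq)
qed

text \<open>Since \<open>p\<^sup>2\<close> does not divide the constant term of the product,
  \<open>p\<close> divides exactly one of the two constant terms, and the one-sided version applies
  with that factor first. A product of degree 0 is treated apart, because \<open>low\<close> then
  says nothing about its constant term.\<close>

lemma eisenstein:
  fixes f g :: "int poly" and p :: int
  assumes p: "prime_elem p"
    and low: "\<And>i. i < degree (f * g) \<Longrightarrow> p dvd coeff (f * g) i"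
    and lead: "\<not> p dvd lead_coeff (f * g)"
    and sq: "\<not> p\<^sup>2 dvd coeff (f * g) 0"
  shows "degree f = 0 \<or> degree g = 0"
proof (cases "degree (f * g) = 0")
  case True
  moreover have "f \<noteq> 0" "g \<noteq> 0" using lead by auto
  ultimately show ?thesis by (simp add: degree_mult_eq)
next
  case False
  then have "p dvd coeff f 0 * coeff g 0"
    using low[of 0] by (simp add: coeff_mult)
  then have "p dvd coeff f 0 \<or> p dvd coeff g 0"
    using p by (simp add: prime_elem_dvd_mult_iff)
  moreover have "\<not> (p dvd coeff f 0 \<and> p dvd coeff g 0)"
    using sq by (auto simp: coeff_mult power2_eq_square mult_dvd_mono)
  ultimately show ?thesis
    using eisenstein_one_sided[OF p low lead] eisenstein_one_sided[of p g f] p low lead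
    by (auto simp: mult.commute)
qed

section \<open>Irreducibility of the cyclotomic polynomial of order p^(n+1)\<close>

definition prime_power_cyclotomic :: "nat \<Rightarrow> nat \<Rightarrow> int poly" where
  "prime_power_cyclotomic p n = (\<Sum>i<p. monom 1 (i * p ^ n))"

text \<open>A geometric sum in \<open>monom 1 (p ^ n)\<close>. For prime \<open>p\<close> the
  identity shows that \<open>prime_power_cyclotomic p n\<close> is the cyclotomic polynomial of
  order \<open>p ^ Suc n\<close>; the index is one below the exponent.\<close>

lemma prime_power_cyclotomic_mult:
  "prime_power_cyclotomic p n * (monom 1 (p ^ n) - 1) = monom 1 (p ^ Suc n) - 1"
  using power_diff_1_eq[of "monom (1::int) (p ^ n)" p]
  by (simp add: prime_power_cyclotomic_def monom_power mult.commute)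

lemma poly_prime_power_cyclotomic_1: "poly (prime_power_cyclotomic p n) 1 = int p"
  by (simp add: prime_power_cyclotomic_def poly_sum poly_monom)

lemma degree_monom_minus_one:
  assumes "k > 0"
  shows "degree (monom (1::int) k - 1) = k" "lead_coeff (monom (1::int) k - 1) = 1"
proof -
  show *: "degree (monom (1::int) k - 1) = k"
    using degree_add_eq_left[of "-1" "monom (1::int) k"] assms by (simp add: degree_monom_eq)
  show "lead_coeff (monom (1::int) k - 1) = 1" 
    using assms unfolding * by simp
qed

lemma degree_prime_power_cyclotomic:
  assumes "p > 0"
  shows "degree (prime_power_cyclotomic p n) = (p - 1) * p ^ n"
    and "lead_coeff (prime_power_cyclotomic p n) = 1"
proof -
  let ?F = "prime_power_cyclotomic p n" and ?M = "monom (1::int) (p ^ n) - 1"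
  have M: "degree ?M = p ^ n" "lead_coeff ?M = 1"
    using degree_monom_minus_one[of "p ^ n"] assms by auto
  have N: "degree (?F * ?M) = p ^ Suc n" "lead_coeff (?F * ?M) = 1"
    unfolding prime_power_cyclotomic_mult using degree_monom_minus_one[of "p ^ Suc n"] assms by auto
  have "?F \<noteq> 0" "?M \<noteq> 0" using N(2) by auto
  then have "degree ?F + p ^ n = p ^ Suc n" using N(1) M by (simp add: degree_mult_eq)
  then show "degree ?F = (p - 1) * p ^ n" using assms by (cases p) auto
  show "lead_coeff ?F = 1" using N(2) M(2) unfolding lead_coeff_mult by simp
qed

text \<open>Divisibility by the constant polynomial \<open>[:int p:]\<close> expresses congruence
  modulo \<open>p\<close>; the inner binomial coefficients of a prime row are multiples of
  \<open>p\<close>.\<close>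

lemma freshman_dream_poly:
  fixes f :: "int poly"
  assumes "Factorial_Ring.prime p"
  shows "[:int p:] dvd (f + 1) ^ p - (f ^ p + 1)"
proof -
  have p: "p > 0" using assms by (simp add: prime_gt_0_nat)
  have "(f + 1) ^ p = (\<Sum>k\<le>p. of_nat (p choose k) * f ^ k)"
    by (simp add: binomial_ring)
  also have "{..p} = insert 0 (insert p {0<..<p})" using p by auto
  also have "(\<Sum>k\<in>\<dots>. of_nat (p choose k) * f ^ k) = f ^ p + 1 + (\<Sum>k\<in>{0<..<p}. of_nat (p choose k) * f ^ k)"
    using p by simp
  finally have "(f + 1) ^ p - (f ^ p + 1) = (\<Sum>k\<in>{0<..<p}. of_nat (p choose k) * f ^ k)" by simp
  also have "[:int p:] dvd \<dots>"
  proof (intro dvd_sum dvd_mult2)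
    fix k assume "k \<in> {0<..<p}"
    then have "p dvd (p choose k)" using assms by (intro dvd_choose_prime) auto
    then obtain c where "p choose k = p * c" by blast
    then have "(of_nat (p choose k) :: int poly) = [:int p:] * of_nat c"
      by (simp add: of_nat_poly)
    then show "[:int p:] dvd (of_nat (p choose k) :: int poly)" by (metis dvd_triv_left)
  qed
  finally show ?thesis .
qed

lemma dvd_diff_power:
  fixes a b d :: "'a :: comm_ring_1"
  assumes "d dvd a - b"
  shows "d dvd a ^ n - b ^ n"
  using assms by (metis dvd_mult2 power_diff_sumr2)

lemma freshman_dream_poly_iterated:
  assumes "Factorial_Ring.prime p"
  shows "[:int p:] dvd (monom 1 1 + 1) ^ (p ^ n) - (monom 1 (p ^ n) + 1 :: int poly)"
proof (induction n)
  case (Suc n)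
  let ?X = "(monom 1 1 + 1 :: int poly) ^ (p ^ n)" and ?Y = "monom 1 (p ^ n) :: int poly"
  have "[:int p:] dvd ?X ^ p - (?Y + 1) ^ p"
    using Suc by (rule dvd_diff_power)
  from dvd_add[OF this freshman_dream_poly[OF assms, of ?Y]]
  have "[:int p:] dvd ?X ^ p - (?Y ^ p + 1)" by (simp only: diff_add_cancel add_diff_eq)
  then show ?case by (simp add: monom_power mult.commute flip: power_mult)
qed simp

text \<open>Substituting X + 1 into the product formula and reducing modulo \<open>p\<close> gives
  F(X+1) X^(p^n) \<equiv> X^(p^(n+1)). The power of X cancels because \<open>[:int p:]\<close> is a
  prime element that does not divide it.\<close>

lemma prime_power_cyclotomic_shift:
  assumes "Factorial_Ring.prime p"
  shows "[:int p:] dvd pcompose (prime_power_cyclotomic p n) [:1, 1:] - monom 1 ((p - 1) * p ^ n)"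
proof -
  let ?F = "pcompose (prime_power_cyclotomic p n) [:1, 1:]"
  let ?Y = "monom 1 (p ^ n) :: int poly"
  have p: "p > 0" using assms by (simp add: prime_gt_0_nat)
  have X: "([:1, 1:] :: int poly) = monom 1 1 + 1" by (simp add: monom_altdef one_pCons)
  have comp: "pcompose (monom 1 k - 1) [:1, 1:] = ([:1, 1:] :: int poly) ^ k - 1" for k
    by (induction k) (simp_all add: pcompose_diff pcompose_1 monom_0 monom_Suc pcompose_pCons)
  have "?F * ([:1, 1:] ^ (p ^ n) - 1) = [:1, 1:] ^ (p ^ Suc n) - 1"
    using arg_cong[OF prime_power_cyclotomic_mult[of p n], of "\<lambda>f. pcompose f [:1, 1:]"]
    by (simp only: pcompose_mult comp)
  moreover have "[:int p:] dvd ([:1, 1:] ^ (p ^ n) - 1) - ?Y"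
    using freshman_dream_poly_iterated[OF assms, of n] unfolding X by (simp add: algebra_simps)
  moreover have "[:int p:] dvd ([:1, 1:] ^ (p ^ Suc n) - 1) - monom 1 (p ^ Suc n)"
    using freshman_dream_poly_iterated[OF assms, of "Suc n"] unfolding X by (simp only: diff_diff_eq add.commute)
  ultimately have "[:int p:] dvd ?F * ?Y - monom 1 (p ^ Suc n)"
  proof -
    assume 1: "?F * ([:1, 1:] ^ (p ^ n) - 1) = [:1, 1:] ^ (p ^ Suc n) - 1"
      and 2: "[:int p:] dvd ([:1, 1:] ^ (p ^ n) - 1) - ?Y"
      and 3: "[:int p:] dvd ([:1, 1:] ^ (p ^ Suc n) - 1) - monom 1 (p ^ Suc n)"
    have "?F * ?Y - monom 1 (p ^ Suc n) = (([:1, 1:] ^ (p ^ Suc n) - 1) - monom 1 (p ^ Suc n))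
       - ?F * (([:1, 1:] ^ (p ^ n) - 1) - ?Y)"
      unfolding right_diff_distrib[of ?F] using 1 by (simp add: algebra_simps)
    then show ?thesis using 2 3 by (metis dvd_diff dvd_mult)
  qed
  also have "monom (1::int) (p ^ Suc n) = monom 1 ((p - 1) * p ^ n) * ?Y"
    using p by (cases p) (simp_all add: mult_monom algebra_simps)
  also have "?F * ?Y - monom 1 ((p - 1) * p ^ n) * ?Y = (?F - monom 1 ((p - 1) * p ^ n)) * ?Y"
    by (simp add: algebra_simps)
  finally have "[:int p:] dvd (?F - monom 1 ((p - 1) * p ^ n)) * ?Y" .
  moreover have "prime_elem [:int p:]"
    using assms by (simp add: prime_elem_const_poly_iff)
  moreover have "\<not> [:int p:] dvd ?Y"
    using assms by (auto simp: const_poly_dvd_iff dest!: spec[of _ "p ^ n"])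
  ultimately show ?thesis by (simp add: prime_elem_dvd_mult_iff)
qed

text \<open>Eisenstein after the shift to X + 1: the lower coefficients vanish modulo
  \<open>p\<close>, and the constant term is the value \<open>p\<close> at 1. The shift preserves
  the degrees of the factors.\<close>

lemma prime_power_cyclotomic_factor:
  assumes p: "Factorial_Ring.prime p" and fg: "prime_power_cyclotomic p n = f * g"
  shows "degree f = 0 \<or> degree g = 0"
proof -
  let ?s = "\<lambda>f :: int poly. pcompose f [:1, 1:]"
  let ?F = "prime_power_cyclotomic p n"
  have p0: "p > 0" using p by (simp add: prime_gt_0_nat)
  have mult: "?s ?F = ?s f * ?s g" by (simp add: fg pcompose_mult)
  have deg: "degree (?s ?F) = (p - 1) * p ^ n"
    by (simp add: degree_pcompose degree_prime_power_cyclotomic p0)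
  have lead: "lead_coeff (?s ?F) = 1"
    using degree_prime_power_cyclotomic(2)[OF p0, of n] by (subst lead_coeff_comp) simp_all
  have low: "int p dvd coeff (?s ?F) i" if "i < degree (?s ?F)" for i
    using prime_power_cyclotomic_shift[OF p, of n] that unfolding deg
    by (auto simp: const_poly_dvd_iff dest!: spec[of _ i])
  have c0: "coeff (?s ?F) 0 = int p"
    by (simp add: poly_prime_power_cyclotomic_1)
  have "degree (?s f) = 0 \<or> degree (?s g) = 0"
  proof (rule eisenstein[where p = "int p"])
    show "\<not> (int p)\<^sup>2 dvd coeff (?s f * ?s g) 0"
      using c0 p0 prime_gt_1_nat[OF p] unfolding mult
      by (simp add: power2_eq_square)
  qed (use p low lead prime_gt_1_nat[OF p] in \<open>auto simp flip: mult\<close>)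
  then show ?thesis by (simp add: degree_pcompose)
qed

section \<open>Sums of roots of unity of prime power order\<close>

abbreviation ipoly :: "int poly \<Rightarrow> complex \<Rightarrow> complex" where
  "ipoly P \<equiv> poly (map_poly of_int P)"

lemma ipoly_add: "ipoly (P + Q) z = ipoly P z + ipoly Q z"
proof -
  have "map_poly of_int (P + Q) = map_poly of_int P + (map_poly of_int Q :: complex poly)"
    by (intro poly_eqI) (simp add: coeff_map_poly)
  then show ?thesis by simp
qed

lemma ipoly_mult: "ipoly (P * Q) z = ipoly P z * ipoly Q z"
proof -
  have "map_poly of_int (P * Q) = map_poly of_int P * (map_poly of_int Q :: complex poly)"
    by (intro poly_eqI) (simp add: coeff_map_poly coeff_mult)
  then show ?thesis by simp
qed

lemma ipoly_diff: "ipoly (P - Q) z = ipoly P z - ipoly Q z"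
  using ipoly_add[of "P - Q" Q z] by simp

lemma ipoly_const: "ipoly [:c:] z = of_int c"
  by (simp add: map_poly_pCons)

lemma ipoly_smult: "ipoly (Polynomial.smult c P) z = of_int c * ipoly P z"
  by (simp add: map_poly_smult)

lemma ipoly_monom: "ipoly (Polynomial.monom c n) z = of_int c * z ^ n"
  by (simp add: map_poly_monom poly_monom)

lemma ipoly_sum: "ipoly (\<Sum>x\<in>A. P x) z = (\<Sum>x\<in>A. ipoly (P x) z)"
  by (induction A rule: infinite_finite_induct) (simp_all add: ipoly_add)

text \<open>Take the primitive part of a polynomial of least degree that vanishes at
  \<open>z\<close>. Pseudo-division keeps integer coefficients, and its remainder vanishes at
  \<open>z\<close>, hence is 0 by minimality.\<close>

lemma primitive_generator_of_annihilator:
  assumes "P0 \<noteq> 0" "ipoly P0 z = 0"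
  obtains g where "g \<noteq> 0" "ipoly g z = 0" "\<And>P. ipoly P z = 0 \<Longrightarrow> g dvd P"
proof -
  define C where "C = (\<lambda>g. g \<noteq> 0 \<and> ipoly g z = 0)"
  obtain g0 where g0: "C g0" and min: "\<And>h. C h \<Longrightarrow> Polynomial.degree g0 \<le> Polynomial.degree h"
    using ex_has_least_nat[of C P0 Polynomial.degree] assms unfolding C_def by blast
  define g where "g = primitive_part g0"
  have g: "g \<noteq> 0" "content g = 1" "Polynomial.degree g = Polynomial.degree g0"
    using g0 by (simp_all add: g_def C_def)
  have "of_int (content g0) * ipoly g z = 0"
    using g0 ipoly_smult[of "content g0" g z] by (simp add: g_def C_def)
  then have root: "ipoly g z = 0" using g0 by (simp add: C_def)
  have "g dvd P" if P: "ipoly P z = 0" for P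
  proof -
    obtain Q R where QR: "pseudo_divmod P g = (Q, R)" by (cases "pseudo_divmod P g")
    define c where "c = Polynomial.lead_coeff g ^ (Suc (Polynomial.degree P) - Polynomial.degree g)"
    have c: "c \<noteq> 0" using g(1) by (simp add: c_def)
    from pseudo_divmod[OF g(1) QR]
    have eq: "Polynomial.smult c P = g * Q + R"
      and deg: "R = 0 \<or> Polynomial.degree R < Polynomial.degree g"
      unfolding c_def by auto
    have "ipoly R z = 0"
      using arg_cong[OF eq, of "\<lambda>f. ipoly f z"] P root
      by (simp add: ipoly_smult ipoly_add ipoly_mult)
    then have "R = 0" using deg min[of R] g(3) unfolding C_def by fastforce
    then have "g dvd Polynomial.smult c P" using eq by simp
    \<comment> \<open>Over the fraction field \<open>c\<close> is a unit; Gauss's lemma for the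
      primitive \<open>g\<close> then brings the divisibility back to integer coefficients.\<close>
    then have "fract_poly g dvd Polynomial.smult (to_fract c) (fract_poly P)"
      by (metis fract_poly_dvd fract_poly_smult)
    then have "fract_poly g dvd fract_poly P"
      using c by (simp add: dvd_smult_iff)
    then show ?thesis using fract_poly_dvdD g(2) by blast
  qed
  with g root that show thesis by blast
qed

text \<open>The generator of the annihilator of \<open>z\<close> divides the cyclotomic polynomial
  and is not constant, so irreducibility makes the cofactor constant, and the leading coefficient 1
  makes it a sign.\<close>

lemma prime_power_cyclotomic_dvd:
  assumes p: "Factorial_Ring.prime p" and z: "ipoly (prime_power_cyclotomic p n) z = 0"
    and P: "ipoly P z = 0"
  shows "prime_power_cyclotomic p n dvd P"
proof -
  let ?F = "prime_power_cyclotomic p n"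
  have lead: "Polynomial.lead_coeff ?F = 1"
    using degree_prime_power_cyclotomic(2)[OF prime_gt_0_nat[OF p]] .
  then have "?F \<noteq> 0" by auto
  then obtain g where g: "g \<noteq> 0" "ipoly g z = 0" "\<And>P. ipoly P z = 0 \<Longrightarrow> g dvd P"
    using primitive_generator_of_annihilator z by metis
  obtain h where h: "?F = g * h" using g(3)[OF z] by blast
  have "Polynomial.degree g \<noteq> 0"
  proof
    assume "Polynomial.degree g = 0"
    then obtain c where "g = [:c:]" by (rule degree_eq_zeroE)
    with g(1,2) show False by (simp add: ipoly_const)
  qed
  with prime_power_cyclotomic_factor[OF p h] have "Polynomial.degree h = 0" by blast
  then obtain c where c: "h = [:c:]" by (rule degree_eq_zeroE)
  have "Polynomial.lead_coeff g * c = 1"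
    using lead unfolding h lead_coeff_mult c by simp
  then have "c = 1 \<or> c = -1" by (auto simp: zmult_eq_1_iff)
  then have "g = ?F * [:c:]" by (auto simp: h c)
  then have "?F dvd g" by (metis dvd_triv_left)
  with g(3)[OF P] show ?thesis by (rule dvd_trans[rotated])
qed

section \<open>Galois conjugation for a primitive root of unity\<close>

lemma power_eq_1_gcd:
  fixes z :: complex
  assumes "z ^ a = 1" "z ^ b = 1" "a \<noteq> 0"
  shows "z ^ gcd a b = 1"
proof -
  obtain x y where "a * x = b * y + gcd a b" using bezout_nat[OF assms(3)] by blast
  then have "z ^ (a * x) = z ^ (b * y) * z ^ gcd a b" by (simp add: power_add)
  then show ?thesis using assms(1,2) by (simp add: power_mult)
qed

lemma norm_root_unity:
  fixes w :: complex
  assumes "w ^ N = 1" "N > 0"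
  shows "cmod w = 1"
proof -
  have "cmod w ^ N = 1 ^ N" using assms(1) by (metis norm_one norm_power power_one)
  then show ?thesis using power_eq_imp_eq_base[of "cmod w" N 1] assms(2) by simp
qed

text \<open>The last two conditions give \<open>z\<close> the exact order \<open>p ^ Suc n\<close>,
  because every proper divisor of \<open>p ^ Suc n\<close> divides \<open>p ^ n\<close>.\<close>

locale prime_power_root =
  fixes p n :: nat and z :: complex
  assumes p: "Factorial_Ring.prime p"
    and root: "z ^ (p ^ Suc n) = 1" and primitive: "z ^ (p ^ n) \<noteq> 1"
begin

lemma p_gt_1: "p > 1" using p by (rule prime_gt_1_nat)

lemma cyclotomic_root: "ipoly (prime_power_cyclotomic p n) z = 0"
proof -
  have "ipoly (prime_power_cyclotomic p n * (Polynomial.monom 1 (p ^ n) - 1)) z = 0"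
    using root unfolding prime_power_cyclotomic_mult by (simp add: ipoly_diff ipoly_monom)
  then show ?thesis using primitive by (simp add: ipoly_mult ipoly_diff ipoly_monom)
qed

lemma coprime_power:
  assumes "\<not> p dvd t"
  shows "prime_power_root p n (z ^ t)"
proof
  show "(z ^ t) ^ (p ^ Suc n) = 1"
    using root by (metis mult.commute power_mult power_one)
  show "(z ^ t) ^ (p ^ n) \<noteq> 1"
  proof
    assume "(z ^ t) ^ (p ^ n) = 1"
    then have "(z ^ (p ^ n)) ^ t = 1" by (metis mult.commute power_mult)
    moreover have "(z ^ (p ^ n)) ^ p = 1" using root by (simp add: mult.commute flip: power_mult)
    moreover have "gcd p t = 1" using p assms by (simp add: prime_imp_coprime)
    ultimately have "z ^ (p ^ n) = 1"
      using power_eq_1_gcd[of "z ^ (p ^ n)" p t] p_gt_1 by simp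
    with primitive show False ..
  qed
qed (rule p)

text \<open>The powers \<open>z ^ i\<close> with \<open>i < p ^ Suc n\<close> are distinct, hence as
  numerous as all complex solutions of the equation.\<close>

lemma generates:
  assumes "w ^ (p ^ Suc n) = 1"
  shows "\<exists>i. w = z ^ i"
proof -
  let ?q = "p ^ Suc n"
  have q: "?q > 0" using p_gt_1 by simp
  \<comment> \<open>Otherwise the exponent could be replaced by its gcd with
    \<open>p ^ Suc n\<close>, a power of \<open>p\<close> that divides \<open>p ^ n\<close>, against
    \<open>primitive\<close>.\<close>
  have no_smaller: "z ^ d \<noteq> 1" if d: "0 < d" "d < ?q" for d
  proof
    assume "z ^ d = 1"
    then have g1: "z ^ gcd d ?q = 1" using power_eq_1_gcd root d by blast
    obtain s where s: "s \<le> Suc n" "gcd d ?q = p ^ s"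
      using divides_primepow_nat[OF p, of "gcd d ?q" "Suc n"] by auto
    have "s \<noteq> Suc n"
    proof
      assume "s = Suc n"
      then have "?q dvd d" using s(2) by (metis gcd_dvd1)
      with d show False by (auto dest: dvd_imp_le)
    qed
    then have "p ^ s dvd p ^ n" using s(1) by (simp add: le_imp_power_dvd)
    then obtain c where "p ^ n = p ^ s * c" by blast
    then have "z ^ (p ^ n) = 1" using g1 s(2) by (simp add: power_mult)
    with primitive show False ..
  qed
  have z0: "z \<noteq> 0" using root q by (metis power_0_left zero_neq_one less_not_refl)
  have *: "z ^ i \<noteq> z ^ j" if "i < j" "j < ?q" for i j
  proof
    assume "z ^ i = z ^ j"
    also have "z ^ j = z ^ i * z ^ (j - i)" using that by (simp flip: power_add)
    finally have "z ^ (j - i) = 1" using z0 by simp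
    moreover have "j - i < ?q" using that by linarith
    ultimately show False using no_smaller[of "j - i"] that by simp
  qed
  have "inj_on (\<lambda>i. z ^ i) {..<?q}"
    by (intro inj_onI) (metis * lessThan_iff linorder_neqE_nat)
  then have "card ((\<lambda>i. z ^ i) ` {..<?q}) = ?q" by (simp add: card_image)
  moreover have "(\<lambda>i. z ^ i) ` {..<?q} \<subseteq> {w. w ^ ?q = 1}"
  proof (intro image_subsetI CollectI)
    fix i
    show "(z ^ i) ^ ?q = 1" using root by (metis mult.commute power_mult power_one)
  qed
  moreover have "finite {w :: complex. w ^ ?q = 1}" "card {w :: complex. w ^ ?q = 1} = ?q"
    using q by (auto intro: finite_roots_unity simp: card_roots_unity_eq simp del: power_Suc)
  ultimately have "(\<lambda>i. z ^ i) ` {..<?q} = {w. w ^ ?q = 1}"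
    by (intro card_subset_eq) auto
  with assms show ?thesis by blast
qed

lemma exponents:
  assumes "\<And>x. x \<in> A \<Longrightarrow> f x ^ (p ^ Suc n) = 1"
  shows "\<exists>e. \<forall>x\<in>A. f x = z ^ e x"
  using assms generates by (intro bchoice) blast

text \<open>This replaces the Galois automorphism taking \<open>z ^ s\<close> to
  \<open>z ^ t\<close>: the sum is the value at \<open>z ^ s\<close> of an integer polynomial, which
  is then divisible by the cyclotomic polynomial and so vanishes at \<open>z ^ t\<close>
  too.\<close>

lemma conjugate_sum_eq_0:
  fixes f :: "'x \<Rightarrow> complex" and c :: "'x \<Rightarrow> int"
  assumes f: "\<And>x. x \<in> A \<Longrightarrow> f x ^ (p ^ Suc n) = 1"
    and sum0: "(\<Sum>x\<in>A. of_int (c x) * f x ^ s) = 0" and s: "\<not> p dvd s" and t: "\<not> p dvd t"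
  shows "(\<Sum>x\<in>A. of_int (c x) * f x ^ t) = 0"
proof -
  obtain e where e: "\<And>x. x \<in> A \<Longrightarrow> f x = z ^ e x"
    using exponents[of A f] f by auto
  define P where "P = (\<Sum>x\<in>A. Polynomial.monom (c x) (e x))"
  have P: "ipoly P (z ^ u) = (\<Sum>x\<in>A. of_int (c x) * f x ^ u)" for u
    unfolding P_def ipoly_sum ipoly_monom
    by (intro sum.cong refl) (metis e mult.commute power_mult)
  interpret S: prime_power_root p n "z ^ s" using s by (rule coprime_power)
  interpret T: prime_power_root p n "z ^ t" using t by (rule coprime_power)
  have "prime_power_cyclotomic p n dvd P"
    by (rule prime_power_cyclotomic_dvd[OF p S.cyclotomic_root]) (simp add: P sum0)
  then have "ipoly P (z ^ t) = 0"
    using T.cyclotomic_root by (auto simp: ipoly_mult elim!: dvdE)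
  then show ?thesis by (simp add: P)
qed

text \<open>Divide a polynomial with value N at \<open>z\<close> by the cyclotomic polynomial. The
  remainder has a rational value at \<open>z\<close>, which forces it to be an integer constant;
  evaluation at 1, where the cyclotomic polynomial takes the value \<open>p\<close>, gives the
  congruence.\<close>

lemma sum_norm_square_cong:
  fixes f :: "'x \<Rightarrow> complex" and N :: real
  assumes f: "\<And>x. x \<in> A \<Longrightarrow> f x ^ (p ^ Suc n) = 1"
    and N: "(cmod (\<Sum>x\<in>A. f x))\<^sup>2 = N" "N \<in> \<rat>"
  obtains k :: int where "N = of_int k" "int p dvd (int (card A))\<^sup>2 - k"
proof -
  let ?F = "prime_power_cyclotomic p n" and ?q = "p ^ Suc n"
  obtain e where e: "\<And>x. x \<in> A \<Longrightarrow> f x = z ^ e x"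
    using exponents[of A f] f by auto
  define P where "P = (\<Sum>x\<in>A. Polynomial.monom (1::int) (e x))"
  \<comment> \<open>\<open>P'\<close> represents the complex conjugate of the sum: the inverse of
    \<open>z\<close> is written as \<open>z ^ (?q - 1)\<close> to keep exponents
    nonnegative.\<close>
  define P' where "P' = (\<Sum>x\<in>A. Polynomial.monom (1::int) ((?q - 1) * e x))"
  have q: "?q > 0" using p_gt_1 by simp
  have "z * cnj z = 1" using norm_root_unity[OF root q] by (simp add: complex_norm_square[symmetric])
  moreover have "z * z ^ (?q - 1) = 1" using root q by (subst power_Suc[symmetric]) (simp del: power_Suc)
  moreover have "z \<noteq> 0" using norm_root_unity[OF root q] by auto
  ultimately have cnj: "cnj z = z ^ (?q - 1)" by (metis mult_cancel_left)
  have "ipoly (P * P') z = (\<Sum>x\<in>A. f x) * cnj (\<Sum>x\<in>A. f x)"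
    unfolding ipoly_mult P_def P'_def ipoly_sum ipoly_monom cnj_sum
    by (intro arg_cong2[of _ _ _ _ "(*)"] sum.cong) (simp_all add: e cnj power_mult del: power_Suc)
  also have "\<dots> = of_real N" using N(1) by (simp only: complex_norm_square[symmetric])
  finally have PP: "ipoly (P * P') z = of_real N" .
  obtain Q R where QR: "pseudo_divmod (P * P') ?F = (Q, R)" by (cases "pseudo_divmod (P * P') ?F")
  have deg: "Polynomial.degree ?F = (p - 1) * p ^ n" "Polynomial.lead_coeff ?F = 1"
    using degree_prime_power_cyclotomic[of p n] p_gt_1 by auto
  then have "?F \<noteq> 0" by auto
  from pseudo_divmod[OF this QR] deg(2)
  have eq: "P * P' = ?F * Q + R" and R: "R = 0 \<or> Polynomial.degree R < Polynomial.degree ?F"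
    by auto
  have "ipoly (P * P') z = ipoly R z"
    unfolding eq ipoly_add ipoly_mult cyclotomic_root by simp
  with PP have Rz: "ipoly R z = of_real N" by simp
  obtain u w :: int where uw: "w > 0" "N = of_int u / of_int w"
    using N(2) by (metis Rats_cases')
  \<comment> \<open>\<open>T\<close> vanishes at \<open>z\<close> but has smaller degree than the
    cyclotomic polynomial dividing it, so it is 0 and \<open>R\<close> is constant.\<close>
  define T where "T = Polynomial.smult w R - [:u:]"
  have "ipoly T z = of_int w * of_real N - of_int u"
    by (simp only: T_def ipoly_diff ipoly_smult ipoly_const Rz)
  also have "\<dots> = 0" using uw by simp
  finally have "?F dvd T" by (rule prime_power_cyclotomic_dvd[OF p cyclotomic_root])
  moreover have "Polynomial.degree T < Polynomial.degree ?F"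
  proof -
    have "0 < Polynomial.degree ?F" using p_gt_1 by (simp add: deg)
    then have "Polynomial.degree (Polynomial.smult w R) < Polynomial.degree ?F"
      using R uw(1) by (auto simp: degree_smult_eq)
    then show ?thesis unfolding T_def
      using \<open>0 < Polynomial.degree ?F\<close> by (intro degree_diff_less) simp_all
  qed
  ultimately have "T = 0" by (metis dvd_imp_degree_le not_le)
  then have smultR: "Polynomial.smult w R = [:u:]" by (simp add: T_def)
  then have "Polynomial.degree R = 0" using uw(1) degree_smult_eq[of w R] by simp
  then obtain k where k: "R = [:k:]" by (rule degree_eq_zeroE)
  have "complex_of_real N = of_real (of_int k)" using Rz unfolding k ipoly_const by simp
  then have N_eq: "N = of_int k" by (simp only: of_real_eq_iff)
  have "poly (P * P') 1 = (int (card A))\<^sup>2"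
    by (simp add: P_def P'_def poly_sum poly_monom power2_eq_square)
  then have "(int (card A))\<^sup>2 = int p * poly Q 1 + k"
    unfolding eq k by (simp add: poly_prime_power_cyclotomic_1)
  then have "int p dvd (int (card A))\<^sup>2 - k" by simp
  with N_eq show thesis by (rule that)
qed

end

section \<open>Parseval's identity for powers of roots of unity\<close>

lemma sum_powers_root_unity:
  fixes u :: complex
  assumes "u ^ N = 1"
  shows "(\<Sum>t<N. u ^ t) = (if u = 1 then of_nat N else 0)"
  using power_diff_1_eq[of u N] assms by auto

lemma root_unity_mult_cnj_eq_1_iff:
  fixes u w :: complex
  assumes "w ^ N = 1" "N > 0"
  shows "u * cnj w = 1 \<longleftrightarrow> u = w"
proof -
  have "w * cnj w = 1" using norm_root_unity[OF assms] by (simp add: complex_norm_square[symmetric])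
  moreover have "cnj w \<noteq> 0" using norm_root_unity[OF assms] by auto
  ultimately show ?thesis by (metis mult_cancel_right)
qed

text \<open>Expanding the squares gives, for each pair, a geometric sum in
  \<open>f x * cnj (f y)\<close>; it is \<open>N\<close> when the ratio of the two values is 1 and 0
  otherwise.\<close>

lemma sum_norm_square_powers:
  fixes f :: "'x \<Rightarrow> complex"
  assumes "finite A" "N > 0" and f: "\<And>x. x \<in> A \<Longrightarrow> f x ^ N = 1"
  shows "(\<Sum>t<N. (cmod (\<Sum>x\<in>A. f x ^ t))\<^sup>2) = real N * real (card {(x, y) \<in> A \<times> A. f x = f y})"
proof -
  have "complex_of_real (\<Sum>t<N. (cmod (\<Sum>x\<in>A. f x ^ t))\<^sup>2)
      = (\<Sum>t<N. (\<Sum>x\<in>A. f x ^ t) * cnj (\<Sum>x\<in>A. f x ^ t))"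
    by (simp only: of_real_sum complex_norm_square)
  also have "\<dots> = (\<Sum>t<N. \<Sum>(x, y)\<in>A \<times> A. (f x * cnj (f y)) ^ t)"
    by (simp add: sum_product sum.cartesian_product power_mult_distrib)
  also have "\<dots> = (\<Sum>(x, y)\<in>A \<times> A. \<Sum>t<N. (f x * cnj (f y)) ^ t)"
    by (subst sum.swap) (simp add: case_prod_unfold)
  also have "\<dots> = (\<Sum>(x, y)\<in>A \<times> A. if f x = f y then of_nat N else 0)"
  proof (intro sum.cong refl, clarsimp simp del: of_nat_eq_0_iff)
    fix x y assume xy: "x \<in> A" "y \<in> A"
    have "(f x * cnj (f y)) ^ N = 1"
      using f xy by (simp add: power_mult_distrib flip: complex_cnj_power)
    then have "(\<Sum>t<N. (f x * cnj (f y)) ^ t) = (if f x * cnj (f y) = 1 then of_nat N else 0)"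
      by (rule sum_powers_root_unity)
    then show "(f x = f y \<longrightarrow> (\<Sum>t<N. (f y * cnj (f y)) ^ t) = of_nat N) \<and>
        (f x \<noteq> f y \<longrightarrow> (\<Sum>t<N. (f x * cnj (f y)) ^ t) = 0)"
      using root_unity_mult_cnj_eq_1_iff[OF f[OF xy(2)] assms(2), of "f x"] by auto
  qed
  also have "\<dots> = (\<Sum>xy\<in>A \<times> A. if xy \<in> {(x, y). f x = f y} then of_nat N else 0)"
    by (intro sum.cong) auto
  also have "\<dots> = of_nat N * of_nat (card (A \<times> A \<inter> {(x, y). f x = f y}))"
    using assms(1) by (subst sum.inter_restrict[symmetric]) auto
  also have "A \<times> A \<inter> {(x, y). f x = f y} = {(x, y) \<in> A \<times> A. f x = f y}" by auto
  also have "of_nat N * of_nat (card {(x, y) \<in> A \<times> A. f x = f y})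
      = complex_of_real (real N * real (card {(x, y) \<in> A \<times> A. f x = f y}))" by simp
  finally show ?thesis by (simp only: of_real_eq_iff)
qed

lemma sum_multiples:
  fixes h :: "nat \<Rightarrow> 'b :: comm_monoid_add"
  assumes "p > 0"
  shows "(\<Sum>t\<in>{t. t < p * M \<and> p dvd t}. h t) = (\<Sum>s<M. h (p * s))"
  by (rule sum.reindex_bij_witness[of _ "\<lambda>s. p * s" "\<lambda>t. t div p"]) (use assms in \<open>auto elim!: dvdE\<close>)

context prime_power_root
begin

text \<open>The congruence for N makes the quotient an integer. The lower bound comes from
  subtracting Parseval over the multiples of \<open>p\<close> from Parseval over all exponents,
  which isolates the exponents where the squared norm is N.\<close>

lemma constant_norm_square_quotient:
  fixes f :: "'x \<Rightarrow> complex" and N :: real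
  assumes A: "finite A" and f: "\<And>x. x \<in> A \<Longrightarrow> f x ^ (p ^ Suc n) = 1"
    and N: "\<And>t. \<not> p dvd t \<Longrightarrow> (cmod (\<Sum>x\<in>A. f x ^ t))\<^sup>2 = N" "N \<in> \<rat>"
  shows "\<exists>r::int. r \<ge> int (card A) \<and> (real (card A))\<^sup>2 + (real p - 1) * N = real p * of_int r"
proof -
  let ?h = "\<lambda>t. (cmod (\<Sum>x\<in>A. f x ^ t))\<^sup>2" and ?c = "card A"
  define E where "E = card {(x, y) \<in> A \<times> A. f x = f y}"
  define E' where "E' = card {(x, y) \<in> A \<times> A. f x ^ p = f y ^ p}"
  have p0: "p > 0" using p_gt_1 by simp
  have all: "(\<Sum>t<p * p ^ n. ?h t) = real p * real p ^ n * real E"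
    using sum_norm_square_powers[OF A, of "p ^ Suc n" f] f p0 by (simp add: E_def)
  \<comment> \<open>The exponents \<open>p * s\<close> with \<open>s < p ^ n\<close> are Parseval
    for the values \<open>f x ^ p\<close>, which are roots of unity of order dividing
    \<open>p ^ n\<close>.\<close>
  have mult: "(\<Sum>t\<in>{t. t < p * p ^ n \<and> p dvd t}. ?h t) = real p ^ n * real E'"
    using sum_norm_square_powers[OF A, of "p ^ n" "\<lambda>x. f x ^ p"] f p0
    by (simp add: E'_def sum_multiples power_mult)
  have "{..<p * p ^ n} = {t. t < p * p ^ n \<and> \<not> p dvd t} \<union> {t. t < p * p ^ n \<and> p dvd t}" by auto
  then have "(\<Sum>t<p * p ^ n. ?h t) = (\<Sum>t\<in>{t. t < p * p ^ n \<and> \<not> p dvd t}. ?h t)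
      + (\<Sum>t\<in>{t. t < p * p ^ n \<and> p dvd t}. ?h t)"
    by (simp only:) (intro sum.union_disjoint, auto)
  also have "(\<Sum>t\<in>{t. t < p * p ^ n \<and> \<not> p dvd t}. ?h t)
      = real (card {t. t < p * p ^ n \<and> \<not> p dvd t}) * N"
    by (simp add: N(1))
  finally have split: "real p * real p ^ n * real E
      = real (card {t. t < p * p ^ n \<and> \<not> p dvd t}) * N + real p ^ n * real E'"
    unfolding all mult .
  have "card {t. t < p * p ^ n \<and> p dvd t} = p ^ n"
    using sum_multiples[OF p0, where M = "p ^ n" and h = "\<lambda>_. 1 :: nat"] by simp
  moreover have "card {t. t < p * p ^ n \<and> \<not> p dvd t} = p * p ^ n - card {t. t < p * p ^ n \<and> p dvd t}"
    by (subst card_Diff_subset[symmetric, where A = "{..<p * p ^ n}", simplified])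
       (auto intro: arg_cong[where f = card])
  ultimately have "card {t. t < p * p ^ n \<and> \<not> p dvd t} = (p - 1) * p ^ n"
    by (simp add: diff_mult_distrib)
  then have "real p ^ n * (real p * real E) = real p ^ n * ((real p - 1) * N + real E')"
    using split p0 by (simp add: of_nat_diff algebra_simps)
  then have pN: "real p * real E = (real p - 1) * N + real E'" using p0 by simp
  \<comment> \<open>Diagonal pairs always agree.\<close>
  have "card ((\<lambda>x. (x, x)) ` A) \<le> E"
    unfolding E_def using A by (intro card_mono) (auto intro: finite_subset[of _ "A \<times> A"])
  then have "?c \<le> E" by (simp add: card_image inj_on_def)
  then have "real p * real ?c \<le> real p * real E" by (simp add: mult_left_mono)
  moreover have "E' \<le> card (A \<times> A)"
    unfolding E'_def using A by (intro card_mono) auto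
  then have "E' \<le> ?c\<^sup>2" by (simp add: power2_eq_square card_cartesian_product)
  then have "real E' \<le> (real ?c)\<^sup>2" by (metis of_nat_le_iff of_nat_power)
  ultimately have le: "real p * real ?c \<le> (real ?c)\<^sup>2 + (real p - 1) * N" using pN by linarith
  have "(cmod (\<Sum>x\<in>A. f x))\<^sup>2 = N" using N(1)[of 1] p_gt_1 by simp
  then obtain k where k: "N = of_int k" "int p dvd (int ?c)\<^sup>2 - k"
    using sum_norm_square_cong[of A f N] f N(2) by blast
  \<comment> \<open>The witness is \<open>k + d\<close>: both N and its defect from the squared
    cardinality are now integers.\<close>
  then obtain d where d: "(int ?c)\<^sup>2 - k = int p * d" by blast
  have "(int ?c)\<^sup>2 + (int p - 1) * k = int p * (k + d)" using d by (simp add: algebra_simps)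
  then have eq: "(real ?c)\<^sup>2 + (real p - 1) * N = real p * of_int (k + d)"
    unfolding k(1) by (metis (no_types, opaque_lifting) of_int_1 of_int_add of_int_diff of_int_mult of_int_of_nat_eq of_int_power)
  with le p0 have "real ?c \<le> of_int (k + d)" by (simp del: of_int_add)
  then have "int ?c \<le> k + d" by linarith
  with eq show ?thesis by blast
qed

end

section \<open>Characters of finite abelian groups\<close>

context group
begin

lemma character_mult:
  assumes "\<chi> \<in> characters G" "x \<in> carrier G" "y \<in> carrier G"
  shows "\<chi> (x \<otimes> y) = \<chi> x * \<chi> y"
  using assms by (auto simp: characters_def hom_def complex_mult_group_def)

lemma character_nonzero:
  assumes "\<chi> \<in> characters G" "x \<in> carrier G"
  shows "\<chi> x \<noteq> 0"
  using assms by (auto simp: characters_def hom_def complex_mult_group_def Pi_def)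

lemma character_one:
  assumes "\<chi> \<in> characters G"
  shows "\<chi> \<one> = 1"
  using character_mult[OF assms, of \<one> \<one>] character_nonzero[OF assms, of \<one>] by simp

lemma character_pow:
  assumes "\<chi> \<in> characters G" "x \<in> carrier G"
  shows "\<chi> (x [^] (n::nat)) = \<chi> x ^ n"
  by (induction n) (use assms in \<open>simp_all add: character_one character_mult\<close>)

lemma character_power_order:
  assumes "\<chi> \<in> characters G" "x \<in> carrier G"
  shows "\<chi> x ^ Coset.order G = 1"
  using character_pow[OF assms, of "Coset.order G"] character_one[OF assms(1)] assms(2)
  by (simp add: pow_order_eq_1)

lemma norm_character:
  assumes "finite (carrier G)" "\<chi> \<in> characters G" "x \<in> carrier G"
  shows "cmod (\<chi> x) = 1"
proof -
  have "cmod (\<chi> x) ^ Coset.order G = 1 ^ Coset.order G"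
    using character_power_order[OF assms(2,3)] by (metis norm_one norm_power power_one)
  then show ?thesis
    using power_eq_imp_eq_base[of "cmod (\<chi> x)" "Coset.order G" 1] assms(1) order_gt_0_iff_finite by simp
qed

lemma character_mult_cnj:
  assumes "finite (carrier G)" "\<chi> \<in> characters G" "x \<in> carrier G"
  shows "\<chi> x * cnj (\<chi> x) = 1"
  using norm_character[OF assms] by (simp add: complex_norm_square[symmetric])

lemma character_inv:
  assumes "finite (carrier G)" "\<chi> \<in> characters G" "x \<in> carrier G"
  shows "\<chi> (inv x) = cnj (\<chi> x)"
proof -
  have "\<chi> x * \<chi> (inv x) = 1"
    using character_mult[OF assms(2,3), of "inv x"] character_one[OF assms(2)] assms(3) by simp
  then show ?thesis
    using character_mult_cnj[OF assms] character_nonzero[OF assms(2,3)] by (metis mult_cancel_left)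
qed

lemma charactersI:
  assumes "\<And>x y. x \<in> carrier G \<Longrightarrow> y \<in> carrier G \<Longrightarrow> f (x \<otimes> y) = f x * f y"
    and "\<And>x. x \<in> carrier G \<Longrightarrow> f x \<noteq> (0 :: complex)"
  shows "(\<lambda>x\<in>carrier G. f x) \<in> characters G"
  using assms by (auto simp: characters_def hom_def complex_mult_group_def)

lemma principal_character_in_characters: "principal_character G \<in> characters G"
  unfolding principal_character_def by (rule charactersI) auto

lemma character_eq_principal_iff:
  assumes "\<chi> \<in> characters G"
  shows "\<chi> = principal_character G \<longleftrightarrow> (\<forall>x\<in>carrier G. \<chi> x = 1)"
  using assms by (auto simp: characters_def principal_character_def extensional_def fun_eq_iff)

lemma finite_characters:
  assumes "finite (carrier G)"
  shows "finite (characters G)"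
proof (rule finite_subset)
  show "characters G \<subseteq> carrier G \<rightarrow>\<^sub>E {w. w ^ Coset.order G = 1}"
    using character_power_order by (auto simp: PiE_def characters_def)
  show "finite (carrier G \<rightarrow>\<^sub>E {w :: complex. w ^ Coset.order G = 1})"
    using assms order_gt_0_iff_finite by (intro finite_PiE) (auto intro: finite_roots_unity simp: Suc_leI)
qed

text \<open>Translation by an element with \<chi>(a) different from 1 permutes the group and scales
  the sum by \<chi>(a).\<close>

lemma sum_nonprincipal_character:
  assumes "finite (carrier G)" "\<chi> \<in> characters G" "\<chi> \<noteq> principal_character G"
  shows "(\<Sum>x\<in>carrier G. \<chi> x) = 0"
proof -
  obtain a where a: "a \<in> carrier G" "\<chi> a \<noteq> 1"
    using assms(2,3) character_eq_principal_iff by blast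
  have "(\<Sum>x\<in>carrier G. \<chi> x) = (\<Sum>x\<in>carrier G. \<chi> (a \<otimes> x))"
    by (rule sum.reindex_bij_witness[of _ "\<lambda>x. a \<otimes> x" "\<lambda>x. inv a \<otimes> x"])
       (use a in \<open>auto simp: m_assoc[symmetric]\<close>)
  also have "\<dots> = \<chi> a * (\<Sum>x\<in>carrier G. \<chi> x)"
    using a assms(2) by (simp add: character_mult sum_distrib_left)
  finally show ?thesis using a(2) by simp
qed

end

section \<open>Separation of points and orthogonality\<close>

context comm_group
begin

text \<open>Each translation is diagonalisable, and the translations commute; hence a function outside
  the kernel of the functional \<open>f \<mapsto> f g - f \<one>\<close> can be projected to common eigenspaces without
  falling into that kernel.\<close>

lemma common_eigenfunction:
  fixes h :: "'a \<Rightarrow> complex"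
  assumes fin: "finite (carrier G)" and g: "g \<in> carrier G" and h: "h g \<noteq> h \<one>"
    and S: "finite S" "S \<subseteq> carrier G"
  shows "\<exists>f. f g \<noteq> f \<one> \<and> (\<forall>a\<in>S. \<exists>w :: complex. \<forall>x\<in>carrier G. f (a \<otimes> x) = w * f x)"
  using S
proof (induction S rule: finite_induct)
  case empty
  then show ?case using h by auto
next
  case (insert a S)
  then have a: "a \<in> carrier G" and S: "S \<subseteq> carrier G" by auto
  from insert.IH[OF S] obtain f where f: "f g \<noteq> f \<one>"
    and eig: "\<forall>b\<in>S. \<exists>w :: complex. \<forall>x\<in>carrier G. f (b \<otimes> x) = w * f x" by (elim exE conjE)
  define N where "N = Coset.order G"
  have N: "N > 0" using fin by (simp add: N_def order_gt_0_iff_finite)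
  \<comment> \<open>Up to a scalar, the projection to the eigenspace of translation by
    \<open>a\<close> with eigenvalue \<open>inverse \<omega>\<close>.\<close>
  define P where "P = (\<lambda>\<omega> x. \<Sum>i<N. \<omega> ^ i * f (a [^] i \<otimes> x))"
  \<comment> \<open>As a polynomial in \<omega>, the difference of the projected values has degree
    below \<open>N\<close> and nonzero constant term, so it cannot vanish at all \<open>N\<close>
    roots of unity.\<close>
  define Q where "Q = (\<Sum>i<N. Polynomial.monom (f (a [^] i \<otimes> g) - f (a [^] i \<otimes> \<one>)) i)"
  have "poly.coeff Q 0 = f g - f \<one>"
    using N g by (simp add: Q_def coeff_sum)
  then have "Q \<noteq> 0" using f by auto
  have Q: "poly Q \<omega> = P \<omega> g - P \<omega> \<one>" for \<omega>
    by (simp add: Q_def P_def poly_sum poly_monom algebra_simps sum_subtractf)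
  have "\<exists>\<omega>. \<omega> ^ N = 1 \<and> poly Q \<omega> \<noteq> 0"
  proof (rule ccontr)
    assume "\<nexists>\<omega>. \<omega> ^ N = 1 \<and> poly Q \<omega> \<noteq> 0"
    then have "{\<omega>. \<omega> ^ N = 1} \<subseteq> {\<omega>. poly Q \<omega> = 0}" by blast
    then have "N \<le> card {\<omega>. poly Q \<omega> = 0}"
      using card_mono[OF poly_roots_finite[OF \<open>Q \<noteq> 0\<close>]] card_roots_unity_eq[OF N] by metis
    also have "\<dots> \<le> Polynomial.degree Q" by (rule card_poly_roots_bound) fact
    also have "\<dots> \<le> N - 1"
      unfolding Q_def by (intro degree_sum_le) (auto intro: order.trans[OF degree_monom_le])
    finally show False using N by simp
  qed
  then obtain \<omega> where \<omega>: "\<omega> ^ N = 1" "P \<omega> g \<noteq> P \<omega> \<one>" by (auto simp: Q)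
  then have \<omega>0: "\<omega> \<noteq> 0" using N by (metis power_0_left zero_neq_one less_not_refl)
  have "P \<omega> (a \<otimes> x) = inverse \<omega> * P \<omega> x" if x: "x \<in> carrier G" for x
  proof -
    \<comment> \<open>Multiplying by \<omega> shifts the index by one, and the sum wraps around
      since \<open>t N = t 0\<close>.\<close>
    define t where "t = (\<lambda>i. \<omega> ^ i * f (a [^] i \<otimes> x))"
    have "\<omega> * P \<omega> (a \<otimes> x) = (\<Sum>i<N. t (Suc i))"
      unfolding P_def t_def sum_distrib_left
      using a x by (intro sum.cong) (simp_all add: m_assoc)
    also have "\<dots> = (\<Sum>i<N. t i) + t N - t 0"
      using sum.lessThan_Suc_shift[of t N] sum.lessThan_Suc[of t N] by simp
    also have "t N = t 0" using \<omega>(1) a x by (simp add: t_def N_def pow_order_eq_1)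
    finally show ?thesis using \<omega>0 by (simp add: P_def t_def field_simps)
  qed
  moreover have "\<exists>w. \<forall>x\<in>carrier G. P \<omega> (b \<otimes> x) = w * P \<omega> x" if b: "b \<in> S" for b
  proof -
    from bspec[OF eig b] obtain w where w: "\<forall>x\<in>carrier G. f (b \<otimes> x) = w * f x" by (rule exE)
    have "P \<omega> (b \<otimes> x) = w * P \<omega> x" if x: "x \<in> carrier G" for x
      unfolding P_def sum_distrib_left
    proof (intro sum.cong refl)
      fix i :: nat
      have "a [^] i \<otimes> (b \<otimes> x) = b \<otimes> (a [^] i \<otimes> x)"
        using a b x S by (intro m_lcomm) auto
      then show "\<omega> ^ i * f (a [^] i \<otimes> (b \<otimes> x)) = w * (\<omega> ^ i * f (a [^] i \<otimes> x))"
        using w a x by simp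
    qed
    then show ?thesis by blast
  qed
  ultimately show ?case using \<omega>(2) by (intro exI[of _ "P \<omega>"]) auto
qed

text \<open>A common eigenfunction of all translations is its value at \<open>\<one>\<close> times
  its eigenvalue function, and the latter is multiplicative. Starting from the indicator of
  \<open>\<one>\<close> keeps the values at \<open>g\<close> and \<open>\<one>\<close>
  apart.\<close>

lemma characters_separate:
  assumes fin: "finite (carrier G)" and g: "g \<in> carrier G" "g \<noteq> \<one>"
  obtains \<chi> where "\<chi> \<in> characters G" "\<chi> g \<noteq> 1"
proof -
  define h where "h = (\<lambda>x. if x = \<one> then 1 else 0 :: complex)"
  have "h g \<noteq> h \<one>" using g by (simp add: h_def)
  from common_eigenfunction[of g h, OF fin g(1) this fin]
  obtain f where f: "f g \<noteq> f \<one>"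
    and "\<forall>a\<in>carrier G. \<exists>w :: complex. \<forall>x\<in>carrier G. f (a \<otimes> x) = w * f x" by blast
  then obtain w where w: "\<And>a x. a \<in> carrier G \<Longrightarrow> x \<in> carrier G \<Longrightarrow> f (a \<otimes> x) = w a * f x"
    by metis
  have fw: "f a = w a * f \<one>" if "a \<in> carrier G" for a using w[of a \<one>] that by simp
  have f1: "f \<one> \<noteq> 0" using fw[OF g(1)] f by auto
  have mult: "w (x \<otimes> y) = w x * w y" if "x \<in> carrier G" "y \<in> carrier G" for x y
    using fw[of "x \<otimes> y"] fw[of y] w[of x y] that f1 by simp
  have "w \<one> = 1" using fw[of \<one>] f1 by simp
  then have "w x \<noteq> 0" if "x \<in> carrier G" for x
    using mult[of x "inv x"] that by auto
  with mult have "(\<lambda>x\<in>carrier G. w x) \<in> characters G" by (intro charactersI)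
  moreover have "w g \<noteq> 1" using fw[OF g(1)] f by auto
  ultimately show thesis using that g(1) by simp
qed

text \<open>Multiplication by a character that is not 1 at \<open>g\<close> permutes the characters
  and scales the sum.\<close>

lemma sum_characters_eq_0:
  assumes fin: "finite (carrier G)" and g: "g \<in> carrier G" "g \<noteq> \<one>"
  shows "(\<Sum>\<chi>\<in>characters G. \<chi> g) = 0"
proof -
  obtain \<psi> where \<psi>: "\<psi> \<in> characters G" "\<psi> g \<noteq> 1" using characters_separate[OF assms] .
  define T where "T = (\<lambda>\<chi>. \<lambda>x\<in>carrier G. \<psi> x * \<chi> x)"
  have T: "T ` characters G \<subseteq> characters G"
    unfolding T_def by (auto intro!: charactersI simp: character_mult \<psi> character_nonzero)
  have inj: "inj_on T (characters G)"
  proof (rule inj_onI)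
    fix \<chi> \<chi>' assume *: "\<chi> \<in> characters G" "\<chi>' \<in> characters G" "T \<chi> = T \<chi>'"
    have "\<chi> x = \<chi>' x" if "x \<in> carrier G" for x
      using fun_cong[OF *(3), of x] that character_nonzero[OF \<psi>(1) that] by (simp add: T_def)
    with *(1,2) show "\<chi> = \<chi>'"
      by (auto simp: characters_def intro: extensionalityI)
  qed
  have "bij_betw T (characters G) (characters G)"
    using endo_inj_surj[OF finite_characters[OF fin] T inj] inj by (simp add: bij_betw_def)
  then have "(\<Sum>\<chi>\<in>characters G. \<chi> g) = (\<Sum>\<chi>\<in>characters G. T \<chi> g)"
    by (rule sum.reindex_bij_betw[symmetric])
  also have "\<dots> = \<psi> g * (\<Sum>\<chi>\<in>characters G. \<chi> g)"
    using g by (simp add: T_def sum_distrib_left)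
  finally show ?thesis using \<psi>(2) by simp
qed

text \<open>Sum all character values in both orders: only the identity contributes in one, only the
  principal character in the other.\<close>

lemma card_characters:
  assumes fin: "finite (carrier G)"
  shows "card (characters G) = Coset.order G"
proof -
  let ?\<chi>\<^sub>0 = "principal_character G"
  have "(\<Sum>x\<in>carrier G. \<Sum>\<chi>\<in>characters G. \<chi> x) = (\<Sum>x\<in>{\<one>}. \<Sum>\<chi>\<in>characters G. \<chi> x)"
    using fin sum_characters_eq_0[OF fin] by (intro sum.mono_neutral_right) auto
  also have "\<dots> = of_nat (card (characters G))" by (simp add: character_one)
  finally have "of_nat (card (characters G)) = (\<Sum>x\<in>carrier G. \<Sum>\<chi>\<in>characters G. \<chi> x)" ..
  also have "\<dots> = (\<Sum>\<chi>\<in>characters G. \<Sum>x\<in>carrier G. \<chi> x)" by (rule sum.swap)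
  also have "\<dots> = (\<Sum>\<chi>\<in>{?\<chi>\<^sub>0}. \<Sum>x\<in>carrier G. \<chi> x)"
    using finite_characters[OF fin] sum_nonprincipal_character[OF fin] principal_character_in_characters
    by (intro sum.mono_neutral_right) auto
  also have "\<dots> = of_nat (Coset.order G)" by (simp add: principal_character_def Coset.order_def)
  finally show ?thesis by (simp only: of_nat_eq_iff)
qed

lemma sum_characters:
  assumes fin: "finite (carrier G)" and "g \<in> carrier G"
  shows "(\<Sum>\<chi>\<in>characters G. \<chi> g) = (if g = \<one> then of_nat (Coset.order G) else 0)"
  using sum_characters_eq_0[OF assms] by (simp add: character_one card_characters[OF fin])

text \<open>Parseval with a map \<open>\<tau>\<close> that need not be injective, so that it applies
  to the image of a set in a Sylow subgroup, counted with multiplicity.\<close>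

lemma sum_characters_norm_square:
  assumes fin: "finite (carrier G)" and A: "finite A" and \<tau>: "\<And>x. x \<in> A \<Longrightarrow> \<tau> x \<in> carrier G"
  shows "(\<Sum>\<chi>\<in>characters G. (cmod (\<Sum>x\<in>A. \<chi> (\<tau> x)))\<^sup>2)
    = real (Coset.order G) * real (card {(x, y) \<in> A \<times> A. \<tau> x = \<tau> y})"
proof -
  have "complex_of_real (\<Sum>\<chi>\<in>characters G. (cmod (\<Sum>x\<in>A. \<chi> (\<tau> x)))\<^sup>2)
      = (\<Sum>\<chi>\<in>characters G. (\<Sum>x\<in>A. \<chi> (\<tau> x)) * cnj (\<Sum>x\<in>A. \<chi> (\<tau> x)))"
    by (simp only: of_real_sum complex_norm_square)
  also have "\<dots> = (\<Sum>\<chi>\<in>characters G. \<Sum>(x, y)\<in>A \<times> A. \<chi> (\<tau> x \<otimes> inv (\<tau> y)))"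
    unfolding cnj_sum sum_product sum.cartesian_product
    by (intro sum.cong refl) (auto simp: character_mult character_inv fin \<tau>)
  also have "\<dots> = (\<Sum>(x, y)\<in>A \<times> A. \<Sum>\<chi>\<in>characters G. \<chi> (\<tau> x \<otimes> inv (\<tau> y)))"
    by (subst sum.swap) (simp add: case_prod_unfold)
  also have "\<dots> = (\<Sum>xy\<in>A \<times> A. if xy \<in> {(x, y). \<tau> x = \<tau> y} then of_nat (Coset.order G) else 0)"
  proof (intro sum.cong refl, clarify)
    fix x y assume "x \<in> A" "y \<in> A"
    then have xy: "\<tau> x \<in> carrier G" "\<tau> y \<in> carrier G" using \<tau> by auto
    then have "\<tau> x \<otimes> inv (\<tau> y) = \<one> \<longleftrightarrow> \<tau> x = \<tau> y"
      by (metis inv_closed inv_equality inv_inv r_inv)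
    then show "(\<Sum>\<chi>\<in>characters G. \<chi> (\<tau> x \<otimes> inv (\<tau> y)))
        = (if (x, y) \<in> {(x, y). \<tau> x = \<tau> y} then of_nat (Coset.order G) else 0)"
      using sum_characters[OF fin, of "\<tau> x \<otimes> inv (\<tau> y)"] xy by simp
  qed
  also have "\<dots> = of_nat (Coset.order G) * of_nat (card (A \<times> A \<inter> {(x, y). \<tau> x = \<tau> y}))"
    using A by (subst sum.inter_restrict[symmetric]) auto
  also have "A \<times> A \<inter> {(x, y). \<tau> x = \<tau> y} = {(x, y) \<in> A \<times> A. \<tau> x = \<tau> y}" by auto
  also have "of_nat (Coset.order G) * of_nat (card {(x, y) \<in> A \<times> A. \<tau> x = \<tau> y})
      = complex_of_real (real (Coset.order G) * real (card {(x, y) \<in> A \<times> A. \<tau> x = \<tau> y}))" by simp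
  finally show ?thesis by (simp only: of_real_eq_iff)
qed

lemma sum_characters_sum:
  assumes fin: "finite (carrier G)" and A: "finite A" and \<tau>: "\<And>x. x \<in> A \<Longrightarrow> \<tau> x \<in> carrier G"
  shows "(\<Sum>\<chi>\<in>characters G. \<Sum>x\<in>A. \<chi> (\<tau> x)) = of_nat (Coset.order G * card {x \<in> A. \<tau> x = \<one>})"
proof -
  have "(\<Sum>\<chi>\<in>characters G. \<Sum>x\<in>A. \<chi> (\<tau> x)) = (\<Sum>x\<in>A. \<Sum>\<chi>\<in>characters G. \<chi> (\<tau> x))"
    by (rule sum.swap)
  also have "\<dots> = (\<Sum>x\<in>A. if \<tau> x = \<one> then of_nat (Coset.order G) else 0)"
    using sum_characters[OF fin \<tau>] by (intro sum.cong) auto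
  also have "\<dots> = of_nat (Coset.order G * card {x \<in> A. \<tau> x = \<one>})"
    using A by (simp flip: sum.inter_filter)
  finally show ?thesis .
qed

section \<open>The power map onto a subgroup of coprime index\<close>

lemma pow_index_mem_subgroup:
  assumes H: "subgroup H G" and fin: "finite (carrier G)" and x: "x \<in> carrier G"
    and w: "w * card H = Coset.order G"
  shows "x [^] w \<in> H"
proof -
  have N: "H \<lhd> G" using H by (rule subgroup_imp_normal)
  interpret Q: group "G Mod H" using N by (rule normal.factorgroup_is_group)
  have "card (rcosets H) * card H = w * card H" using lagrange[OF H] w by simp
  moreover have "card H > 0"
    using H fin by (metis card_gt_0_iff subgroup.subset subgroup.one_closed finite_subset empty_iff)
  \<comment> \<open>The quotient has order \<open>w\<close>, so the \<open>w\<close>-th power of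
    each coset is trivial.\<close>
  ultimately have ord: "Coset.order (G Mod H) = w" by (simp add: Coset.order_def FactGroup_def)
  have hom: "(\<lambda>a. H #> a) \<in> hom G (G Mod H)" using N by (rule normal.r_coset_hom_Mod)
  have "H #> x [^] w = (H #> x) [^]\<^bsub>G Mod H\<^esub> w"
    using hom_nat_pow[OF hom x _ Q.is_group, of w] is_group by simp
  also have "\<dots> = \<one>\<^bsub>G Mod H\<^esub>"
    using Q.pow_order_eq_1[of "H #> x"] hom x unfolding ord by (auto simp: hom_def)
  also have "\<dots> = H" by simp
  finally show ?thesis
    using H x by (metis nat_pow_closed coset_join1 subgroup.subset)
qed

text \<open>An element of \<open>H\<close> killed by \<open>w\<close> has order dividing the coprime
  numbers \<open>w\<close> and \<open>card H\<close>; thus the power map is injective on a finite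
  set.\<close>

lemma pow_coprime_surj_subgroup:
  assumes H: "subgroup H G" and fin: "finite (carrier G)" and w: "coprime w (card H)"
  shows "(\<lambda>x. x [^] w) ` H = H"
proof (rule endo_inj_surj)
  have sub: "H \<subseteq> carrier G" using H by (rule subgroup.subset)
  show "finite H" using sub fin by (rule finite_subset)
  interpret K: group "G\<lparr>carrier := H\<rparr>" using H by (rule subgroup_imp_group)
  show "(\<lambda>x. x [^] w) ` H \<subseteq> H"
    using K.nat_pow_closed by (auto simp flip: nat_pow_consistent)
  show "inj_on (\<lambda>x. x [^] w) H"
  proof (rule inj_onI)
    fix x y assume xy: "x \<in> H" "y \<in> H" "x [^] w = y [^] w"
    define u where "u = x \<otimes> inv y"
    have u: "u \<in> H" "u \<in> carrier G"
      using xy H sub by (auto simp: u_def subgroup.m_closed subgroup.m_inv_closed)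
    have "u [^] w = x [^] w \<otimes> inv (y [^] w)"
      unfolding u_def using xy(1,2) sub by (subst nat_pow_distrib) (auto simp: nat_pow_inv)
    then have "u [^] w = \<one>" using xy sub by auto
    then have "ord u dvd w" using u by (simp add: pow_eq_id)
    moreover have "u [^] card H = \<one>"
      using K.pow_order_eq_1[of u] u by (simp add: Coset.order_def flip: nat_pow_consistent)
    then have "ord u dvd card H" using u by (simp add: pow_eq_id)
    ultimately have "ord u = 1" using w by (metis coprime_common_divisor_nat)
    then have "u = \<one>" using u pow_ord_eq_1[of u] by simp
    moreover have "x \<in> carrier G" "y \<in> carrier G" using xy sub by auto
    ultimately show "x = y" using inv_solve_right'[of \<one> x y] by (simp add: u_def)
  qed
qed

text \<open>The map \<open>x [^] w\<close> serves as the projection of the group onto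
  \<open>H\<close>. It differs from the direct-product projection at most by an automorphism of
  \<open>H\<close>, which is harmless when all characters of \<open>H\<close> are
  considered.\<close>

lemma pullback_character:
  assumes H: "subgroup H G" and fin: "finite (carrier G)"
    and w: "w * card H = Coset.order G" "coprime w (card H)"
    and \<psi>: "\<psi> \<in> characters (G\<lparr>carrier := H\<rparr>)"
  shows "(\<lambda>x\<in>carrier G. \<psi> (x [^] w)) \<in> characters G"
    and "\<psi> \<noteq> principal_character (G\<lparr>carrier := H\<rparr>)
      \<Longrightarrow> (\<lambda>x\<in>carrier G. \<psi> (x [^] w)) \<noteq> principal_character G"
    and "x \<in> carrier G \<Longrightarrow> \<psi> (x [^] w) ^ card H = 1"
proof -
  interpret K: group "G\<lparr>carrier := H\<rparr>" using H by (rule subgroup_imp_group)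
  have pow: "x [^] w \<in> H" if "x \<in> carrier G" for x
    using pow_index_mem_subgroup[OF H fin that w(1)] .
  show char: "(\<lambda>x\<in>carrier G. \<psi> (x [^] w)) \<in> characters G"
  proof (rule charactersI)
    fix x y assume "x \<in> carrier G" "y \<in> carrier G"
    then show "\<psi> ((x \<otimes> y) [^] w) = \<psi> (x [^] w) * \<psi> (y [^] w)"
      using K.character_mult[OF \<psi>, of "x [^] w" "y [^] w"] pow by (simp add: nat_pow_distrib)
  qed (use K.character_nonzero[OF \<psi>] pow in simp)
  show "x \<in> carrier G \<Longrightarrow> \<psi> (x [^] w) ^ card H = 1"
    using K.character_power_order[OF \<psi>, of "x [^] w"] pow by (simp add: Coset.order_def)
  assume "\<psi> \<noteq> principal_character (G\<lparr>carrier := H\<rparr>)"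
  then obtain y where y: "y \<in> H" "\<psi> y \<noteq> 1"
    using K.character_eq_principal_iff[OF \<psi>] by auto
  obtain x where "x \<in> H" "y = x [^] w"
    using pow_coprime_surj_subgroup[OF H fin w(2)] y(1) by blast
  then have "x \<in> carrier G" "(\<lambda>x\<in>carrier G. \<psi> (x [^] w)) x \<noteq> 1"
    using y(2) subgroup.subset[OF H] by auto
  then show "(\<lambda>x\<in>carrier G. \<psi> (x [^] w)) \<noteq> principal_character G"
    using character_eq_principal_iff[OF char] by blast
qed

end

section \<open>Character values of strong external difference families\<close>

lemma char_ext_gr_set:
  assumes "finite (carrier G)" "A \<subseteq> carrier G"
  shows "char_ext G \<chi> (gr_set A) = (\<Sum>x\<in>A. \<chi> x)"
proof -
  have "char_ext G \<chi> (gr_set A) = (\<Sum>x\<in>carrier G. if x \<in> A then \<chi> x else 0)"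
    unfolding char_ext_def gr_set_def by (intro sum.cong) auto
  also have "\<dots> = (\<Sum>x\<in>carrier G \<inter> A. \<chi> x)" using assms(1) by (simp add: sum.inter_restrict)
  also have "carrier G \<inter> A = A" using assms(2) by blast
  finally show ?thesis .
qed

lemma (in group) char_ext_gr_mult:
  assumes \<chi>: "\<chi> \<in> characters G"
  shows "char_ext G \<chi> (gr_mult G x y) = char_ext G \<chi> x * char_ext G \<chi> y"
proof -
  let ?C = "carrier G"
  have shift: "(\<Sum>g\<in>?C. of_int (y (inv h \<otimes> g)) * \<chi> g) = \<chi> h * char_ext G \<chi> y" if h: "h \<in> ?C" for h
  proof -
    have "(\<Sum>g\<in>?C. of_int (y (inv h \<otimes> g)) * \<chi> g) = (\<Sum>g\<in>?C. of_int (y g) * \<chi> (h \<otimes> g))"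
      by (rule sum.reindex_bij_witness[of _ "\<lambda>g. h \<otimes> g" "\<lambda>g. inv h \<otimes> g"])
         (use h in \<open>auto simp: m_assoc[symmetric]\<close>)
    also have "\<dots> = \<chi> h * char_ext G \<chi> y"
      unfolding char_ext_def sum_distrib_left
      using h \<chi> by (intro sum.cong) (simp_all add: character_mult)
    finally show ?thesis .
  qed
  have "char_ext G \<chi> (gr_mult G x y)
      = (\<Sum>g\<in>?C. \<Sum>h\<in>?C. of_int (x h) * (of_int (y (inv h \<otimes> g)) * \<chi> g))"
    unfolding char_ext_def gr_mult_def
    by (intro sum.cong) (simp_all add: sum_distrib_right mult.assoc)
  also have "\<dots> = (\<Sum>h\<in>?C. of_int (x h) * (\<Sum>g\<in>?C. of_int (y (inv h \<otimes> g)) * \<chi> g))"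
    by (subst sum.swap) (simp add: sum_distrib_left)
  also have "\<dots> = (\<Sum>h\<in>?C. of_int (x h) * \<chi> h * char_ext G \<chi> y)"
    by (intro sum.cong) (simp_all add: shift)
  also have "\<dots> = char_ext G \<chi> x * char_ext G \<chi> y"
    by (simp add: char_ext_def sum_distrib_right)
  finally show ?thesis .
qed

text \<open>The equation makes the ratio \<open>x / S\<close> real and turns it into a root of a
  real quadratic, whose discriminant is a square by the hypothesis on the norm of
  \<open>S\<close>.\<close>

lemma component_of_nonvanishing_total:
  fixes x S :: complex and a b l :: real
  assumes eq: "x * cnj (S - x) = - of_real l" and S: "S \<noteq> 0" and a: "a > 0"
    and N: "(cmod S)\<^sup>2 * (b\<^sup>2 - a\<^sup>2) = 4 * a\<^sup>2 * l"
  shows "of_real (2 * a) * x = of_real (a + b) * S \<or> of_real (2 * a) * x = of_real (a - b) * S"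
proof -
  define \<alpha> where "\<alpha> = x / S"
  define n where "n = (cmod S)\<^sup>2"
  have x: "x = \<alpha> * S" using S by (simp add: \<alpha>_def)
  have n: "n > 0" using S by (simp add: n_def)
  have SS: "S * cnj S = of_real n" by (simp add: n_def complex_norm_square[symmetric])
  have "x * cnj (S - x) = (\<alpha> - \<alpha> * cnj \<alpha>) * (S * cnj S)" unfolding x by (simp add: algebra_simps)
  then have "(\<alpha> - of_real ((cmod \<alpha>)\<^sup>2)) * of_real n = - of_real l"
    unfolding SS eq complex_norm_square by simp
  then have "\<alpha> = of_real ((cmod \<alpha>)\<^sup>2 - l / n)" using n by (simp add: field_simps)
  then obtain r where r: "\<alpha> = of_real r" by blast
  then have "of_real ((r - r\<^sup>2) * n) = (of_real (- l) :: complex)"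
    using \<open>(\<alpha> - of_real ((cmod \<alpha>)\<^sup>2)) * of_real n = - of_real l\<close> by simp
  then have rn: "(r - r\<^sup>2) * n = - l" by (simp only: of_real_eq_iff)
  \<comment> \<open>Completing the square, scaled by 2a to avoid fractions.\<close>
  have "n * (2 * a * r - a)\<^sup>2 = n * a\<^sup>2 - 4 * a\<^sup>2 * ((r - r\<^sup>2) * n)"
    by (simp add: power2_eq_square algebra_simps)
  also have "\<dots> = n * b\<^sup>2" using N unfolding rn n_def[symmetric] by (simp add: algebra_simps)
  finally have "(2 * a * r - a)\<^sup>2 = b\<^sup>2" using n by simp
  then have "2 * a * r = a + b \<or> 2 * a * r = a - b" unfolding power2_eq_iff by auto
  then show ?thesis unfolding x r by (metis mult.assoc of_real_mult)
qed

section \<open>Families with the simple character value property\<close>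

locale simple_SEDF = comm_group G for G :: "('a, 'b) monoid_scheme" (structure) +
  fixes v m k l :: nat and D :: "nat \<Rightarrow> 'a set" and a b :: int
  assumes fin: "finite (carrier G)" and SEDF: "is_SEDF G v m k l D"
    and simple: "simple_character_value_property G m l D a b"
begin

definition U :: "'a set" where "U = (\<Union>i\<in>{1..m}. D i)"

text \<open>The squared norm of \<chi>(D) obtained by solving sqrt(1 + 4\<lambda>/|\<chi>(D)|^2) =
  b/a.\<close>

definition N :: real where "N = 4 * (of_int a)\<^sup>2 * real l / ((of_int b)\<^sup>2 - (of_int a)\<^sup>2)"

lemma m_ge_2: "m \<ge> 2" and order_eq: "Coset.order G = v"
  using SEDF by (auto simp: is_SEDF_def)

lemma D_subset: "i \<in> {1..m} \<Longrightarrow> D i \<subseteq> carrier G"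
  and card_D: "i \<in> {1..m} \<Longrightarrow> card (D i) = k"
  using SEDF by (auto simp: is_SEDF_def)

lemma finite_D: "i \<in> {1..m} \<Longrightarrow> finite (D i)"
  using D_subset fin finite_subset by blast

lemma disjoint: "i \<in> {1..m} \<Longrightarrow> j \<in> {1..m} \<Longrightarrow> i \<noteq> j \<Longrightarrow> D i \<inter> D j = {}"
  using SEDF by (auto simp: is_SEDF_def disjoint_family_on_def)

lemma U_subset: "U \<subseteq> carrier G" and finite_U: "finite U" and D_subset_U: "i \<in> {1..m} \<Longrightarrow> D i \<subseteq> U"
  unfolding U_def using D_subset finite_D by (blast, blast, blast)

lemma sum_U: "(\<Sum>x\<in>U. f x) = (\<Sum>i\<in>{1..m}. \<Sum>x\<in>D i. f x)" for f :: "'a \<Rightarrow> 'c :: comm_monoid_add"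
  unfolding U_def using finite_D disjoint by (intro sum.UNION_disjoint) auto

lemma card_U: "card U = k * m"
  using sum_U[of "\<lambda>_. 1 :: nat"] card_D by (simp add: mult.commute)

lemma character_equation:
  assumes \<chi>: "\<chi> \<in> characters G" "\<chi> \<noteq> principal_character G" and j: "j \<in> {1..m}"
  shows "(\<Sum>x\<in>D j. \<chi> x) * cnj ((\<Sum>x\<in>U. \<chi> x) - (\<Sum>x\<in>D j. \<chi> x)) = - of_real (real l)"
proof -
  let ?rest = "\<lambda>g. \<Sum>i\<in>{1..m} - {j}. gr_set (m_inv G ` D i) g"
  \<comment> \<open>Character values have norm 1, so inversion in the group becomes complex
    conjugation.\<close>
  have inv_sum: "(\<Sum>x\<in>m_inv G ` D i. \<chi> x) = cnj (\<Sum>x\<in>D i. \<chi> x)" if i: "i \<in> {1..m}" for i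
  proof -
    have inj: "inj_on (m_inv G) (D i)"
      using D_subset[OF i] by (intro inj_onI) (metis inv_inv subsetD)
    have "(\<Sum>x\<in>m_inv G ` D i. \<chi> x) = (\<Sum>x\<in>D i. \<chi> (inv x))" using inj by (simp add: sum.reindex)
    also have "\<dots> = (\<Sum>x\<in>D i. cnj (\<chi> x))"
      using D_subset[OF i] \<chi>(1) by (intro sum.cong) (auto simp: character_inv fin)
    finally show ?thesis by simp
  qed
  have "char_ext G \<chi> ?rest = (\<Sum>i\<in>{1..m} - {j}. char_ext G \<chi> (gr_set (m_inv G ` D i)))"
    unfolding char_ext_def of_int_sum sum_distrib_right by (rule sum.swap)
  also have "\<dots> = (\<Sum>i\<in>{1..m} - {j}. cnj (\<Sum>x\<in>D i. \<chi> x))"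
  proof (intro sum.cong refl)
    fix i assume "i \<in> {1..m} - {j}"
    then have i: "i \<in> {1..m}" by blast
    have "m_inv G ` D i \<subseteq> carrier G" using D_subset[OF i] by auto
    then show "char_ext G \<chi> (gr_set (m_inv G ` D i)) = cnj (\<Sum>x\<in>D i. \<chi> x)"
      using fin by (simp add: char_ext_gr_set inv_sum[OF i])
  qed
  also have "\<dots> = cnj ((\<Sum>x\<in>U. \<chi> x) - (\<Sum>x\<in>D j. \<chi> x))"
    unfolding sum_U sum.remove[OF finite_atLeastAtMost j] by simp
  finally have rest: "char_ext G \<chi> ?rest = cnj ((\<Sum>x\<in>U. \<chi> x) - (\<Sum>x\<in>D j. \<chi> x))" .
  have "gr_mult G (gr_set (D j)) ?rest = (\<lambda>g. int l * (gr_set (carrier G) g - gr_set {\<one>} g))"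
    using SEDF j by (auto simp: is_SEDF_def)
  then have "char_ext G \<chi> (gr_set (D j)) * char_ext G \<chi> ?rest
      = char_ext G \<chi> (\<lambda>g. int l * (gr_set (carrier G) g - gr_set {\<one>} g))"
    by (simp only: char_ext_gr_mult[OF \<chi>(1), symmetric])
  also have "\<dots> = of_nat l * (char_ext G \<chi> (gr_set (carrier G)) - char_ext G \<chi> (gr_set {\<one>}))"
    by (simp add: char_ext_def sum_distrib_left sum_subtractf algebra_simps)
  also have "\<dots> = - of_real (real l)"
    using fin \<chi> by (simp add: char_ext_gr_set sum_nonprincipal_character character_one)
  finally show ?thesis
    unfolding rest using char_ext_gr_set[OF fin D_subset[OF j]] by simp
qed

lemma norm_square_component_vanishing:
  assumes "\<chi> \<in> characters G" "\<chi> \<noteq> principal_character G" "j \<in> {1..m}" "(\<Sum>x\<in>U. \<chi> x) = 0"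
  shows "(cmod (\<Sum>x\<in>D j. \<chi> x))\<^sup>2 = real l"
proof -
  have "(\<Sum>x\<in>D j. \<chi> x) * cnj (\<Sum>x\<in>D j. \<chi> x) = of_real (real l)"
    using character_equation[OF assms(1-3)] assms(4) by simp
  then show ?thesis by (simp only: complex_norm_square[symmetric] of_real_eq_iff)
qed

text \<open>The inequalities for \<open>a\<close> and \<open>b\<close> are extracted from a
  nonvanishing character, since the simple character value property is vacuous when there is
  none.\<close>

lemma value_pair:
  assumes "\<chi> \<in> characters G" "\<chi> \<noteq> principal_character G" "(\<Sum>x\<in>U. \<chi> x) \<noteq> 0"
  shows "0 < a" "a < b" "(cmod (\<Sum>x\<in>U. \<chi> x))\<^sup>2 = N"
proof -
  let ?n = "(cmod (\<Sum>x\<in>U. \<chi> x))\<^sup>2"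
  have ext: "char_ext G \<chi> (gr_set U) = (\<Sum>x\<in>U. \<chi> x)" by (rule char_ext_gr_set[OF fin U_subset])
  have "char_value_pair G l U \<chi> a b"
    using simple assms ext
    by (auto simp: simple_character_value_property_def nonvanishing_characters_def U_def)
  then have ab: "0 < a" "a < b" and root: "sqrt (1 + 4 * real l / ?n) = of_int b / of_int a"
    by (auto simp: char_value_pair_def ext)
  show "0 < a" "a < b" by fact+
  have n: "?n > 0" using assms(3) by simp
  have "1 + 4 * real l / ?n = (of_int b / of_int a)\<^sup>2"
    using root n by (metis add_nonneg_nonneg divide_nonneg_nonneg mult_nonneg_nonneg of_nat_0_le_iff
        real_sqrt_pow2 zero_le_numeral zero_le_one zero_le_power2)
  then have "?n * ((of_int b)\<^sup>2 - (of_int a)\<^sup>2) = 4 * (of_int a)\<^sup>2 * real l"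
    using n ab by (simp add: field_simps)
  moreover have "(of_int a :: real)\<^sup>2 < (of_int b)\<^sup>2" using ab by (intro power_strict_mono) auto
  ultimately show "?n = N" by (simp add: N_def eq_divide_eq)
qed

lemma component_nonvanishing:
  assumes \<chi>: "\<chi> \<in> characters G" "\<chi> \<noteq> principal_character G" "(\<Sum>x\<in>U. \<chi> x) \<noteq> 0" and j: "j \<in> {1..m}"
  shows "\<exists>c\<in>{a + b, a - b}. of_int (2 * a) * (\<Sum>x\<in>D j. \<chi> x) = of_int c * (\<Sum>x\<in>U. \<chi> x)"
proof -
  note ab = value_pair(1,2)[OF \<chi>]
  have "(of_int a :: real)\<^sup>2 < (of_int b)\<^sup>2" using ab by (intro power_strict_mono) auto
  then have "(cmod (\<Sum>x\<in>U. \<chi> x))\<^sup>2 * ((of_int b)\<^sup>2 - (of_int a)\<^sup>2) = 4 * (of_int a)\<^sup>2 * real l"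
    unfolding value_pair(3)[OF \<chi>] N_def by simp
  from component_of_nonvanishing_total[OF character_equation[OF \<chi>(1,2) j] \<chi>(3) _ this] ab(1)
  show ?thesis by auto
qed

text \<open>The ratios \<open>\<chi>(D\<^sub>j) / \<chi>(D)\<close> sum to \<open>1\<close>, and the two possible ratios are larger than \<open>1\<close> and
  negative, respectively.\<close>

lemma both_components_occur:
  assumes \<chi>: "\<chi> \<in> characters G" "\<chi> \<noteq> principal_character G" "(\<Sum>x\<in>U. \<chi> x) \<noteq> 0"
    and c: "c \<in> {a + b, a - b}"
  shows "\<exists>j\<in>{1..m}. of_int (2 * a) * (\<Sum>x\<in>D j. \<chi> x) = of_int c * (\<Sum>x\<in>U. \<chi> x)"
proof (rule ccontr)
  assume none: "\<not> ?thesis"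
  \<comment> \<open>The other of the two admissible coefficients, as a + b and a - b add up to
    2a.\<close>
  define c' where "c' = 2 * a - c"
  note ab = value_pair(1,2)[OF \<chi>]
  have other: "of_int (2 * a) * (\<Sum>x\<in>D j. \<chi> x) = of_int c' * (\<Sum>x\<in>U. \<chi> x)" if j: "j \<in> {1..m}" for j
  proof -
    obtain d where d: "d \<in> {a + b, a - b}" "of_int (2 * a) * (\<Sum>x\<in>D j. \<chi> x) = of_int d * (\<Sum>x\<in>U. \<chi> x)"
      using component_nonvanishing[OF \<chi> j] by blast
    then have "d \<noteq> c" using none j by blast
    then have "d = c'" using c d(1) by (auto simp: c'_def)
    then show ?thesis using d(2) by simp
  qed
  have "of_int (2 * a) * (\<Sum>x\<in>U. \<chi> x) = (\<Sum>j\<in>{1..m}. of_int c' * (\<Sum>x\<in>U. \<chi> x))"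
    unfolding sum_U[of \<chi>] sum_distrib_left[of "of_int (2 * a)"]
    using other by (intro sum.cong) (simp_all add: sum_U[of \<chi>] sum_distrib_left)
  also have "\<dots> = of_int (int m * c') * (\<Sum>x\<in>U. \<chi> x)" by simp
  finally have "(of_int (2 * a) :: complex) = of_int (int m * c')" using \<chi>(3) by simp
  then have eq: "2 * a = int m * c'" by (simp only: of_int_eq_iff)
  show False
  proof (cases "c = a + b")
    case True
    then have "int m * c' \<le> 0" using ab by (simp add: c'_def mult_le_0_iff)
    with eq ab show False by linarith
  next
    case False
    then have c': "c' = a + b" using c by (simp add: c'_def)
    have "2 * c' \<le> int m * c'" using m_ge_2 ab unfolding c' by (intro mult_right_mono) auto
    with eq ab c' show False by linarith
  qed
qed

section \<open>The two alternatives of the theorem\<close>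

lemma vanishing_alternative:
  assumes H: "subgroup H G" and w: "w * card H = v" "coprime w (card H)"
    and vanish: "\<And>\<psi>. \<psi> \<in> characters (G\<lparr>carrier := H\<rparr>) \<Longrightarrow> \<psi> \<noteq> principal_character (G\<lparr>carrier := H\<rparr>)
      \<Longrightarrow> (\<Sum>x\<in>U. \<psi> (x [^] w)) = 0"
  shows "card H dvd k * m"
    and "\<exists>r::int. r \<ge> int k \<and> (int k)\<^sup>2 + (int (card H) - 1) * int l = int (card H) * r"
proof -
  let ?K = "G\<lparr>carrier := H\<rparr>"
  interpret K: comm_group ?K
    using subgroup.subgroup_is_group[OF H is_group] subgroup.mem_carrier[OF H] m_comm
    by (intro group.group_comm_groupI) auto
  have index: "w * card H = Coset.order G" using w(1) order_eq by simp
  have H_sub: "H \<subseteq> carrier G" using H by (rule subgroup.subset)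
  have finK: "finite (carrier ?K)" using finite_subset[OF H_sub fin] by simp
  have "card H > 0" using finK subgroup.one_closed[OF H] by (auto simp: card_gt_0_iff)
  have ordK: "Coset.order ?K = card H" by (simp add: Coset.order_def)
  have pow: "x [^] w \<in> H" if "x \<in> carrier G" for x
    using pow_index_mem_subgroup[OF H fin that index] .
  have principal: "principal_character ?K x = 1" if "x \<in> H" for x
    using that by (simp add: principal_character_def)
  have sum_split: "(\<Sum>\<psi>\<in>characters ?K. f \<psi>)
      = f (principal_character ?K) + (\<Sum>\<psi>\<in>characters ?K - {principal_character ?K}. f \<psi>)"
    for f :: "('a \<Rightarrow> complex) \<Rightarrow> 'd :: comm_monoid_add"
    using K.finite_characters[OF finK] K.principal_character_in_characters by (rule sum.remove)
  \<comment> \<open>Only the principal character survives, so the total is km; orthogonality counts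
    it as \<open>card H\<close> times the number of elements of \<open>U\<close> with trivial image
    in \<open>H\<close>.\<close>
  have "(\<Sum>\<psi>\<in>characters ?K. \<Sum>x\<in>U. \<psi> (x [^] w)) = (\<Sum>x\<in>U. 1)"
    unfolding sum_split using vanish pow U_subset by (auto simp: principal subset_iff)
  moreover have "(\<Sum>\<psi>\<in>characters ?K. \<Sum>x\<in>U. \<psi> (x [^] w))
      = of_nat (card H * card {x \<in> U. x [^] w = \<one>})"
    using K.sum_characters_sum[OF finK finite_U, of "\<lambda>x. x [^] w"] pow U_subset
    by (auto simp: ordK)
  ultimately have "(of_nat (k * m) :: complex) = of_nat (card H * card {x \<in> U. x [^] w = \<one>})"
    by (simp add: card_U)
  then have "k * m = card H * card {x \<in> U. x [^] w = \<one>}" by (simp only: of_nat_eq_iff)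
  then show "card H dvd k * m" by simp

  have one: "1 \<in> {1..m}" using m_ge_2 by simp
  \<comment> \<open>The witness for (1b): pairs of \<open>D 1\<close> with equal image in
    \<open>H\<close>, bounded below by the diagonal.\<close>
  define E where "E = card {(x, y) \<in> D 1 \<times> D 1. x [^] w = y [^] w}"
  have norm: "(cmod (\<Sum>x\<in>D 1. \<psi> (x [^] w)))\<^sup>2 = real l"
    if \<psi>: "\<psi> \<in> characters ?K" "\<psi> \<noteq> principal_character ?K" for \<psi>
  proof -
    define \<chi> where "\<chi> = (\<lambda>x\<in>carrier G. \<psi> (x [^] w))"
    have \<chi>: "\<chi> \<in> characters G" "\<chi> \<noteq> principal_character G"
      unfolding \<chi>_def using pullback_character[OF H fin index w(2) \<psi>(1)] \<psi>(2) by blast+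
    have "(\<Sum>x\<in>U. \<chi> x) = (\<Sum>x\<in>U. \<psi> (x [^] w))"
      using U_subset by (intro sum.cong) (auto simp: \<chi>_def)
    then have "(cmod (\<Sum>x\<in>D 1. \<chi> x))\<^sup>2 = real l"
      using norm_square_component_vanishing[OF \<chi> one] vanish[OF \<psi>] by simp
    moreover have "(\<Sum>x\<in>D 1. \<chi> x) = (\<Sum>x\<in>D 1. \<psi> (x [^] w))"
      using D_subset[OF one] by (intro sum.cong) (auto simp: \<chi>_def)
    ultimately show ?thesis by simp
  qed
  have "(\<Sum>\<psi>\<in>characters ?K. (cmod (\<Sum>x\<in>D 1. \<psi> (x [^] w)))\<^sup>2)
      = (cmod (\<Sum>x\<in>D 1. 1))\<^sup>2 + real (card (characters ?K - {principal_character ?K})) * real l"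
    unfolding sum_split using norm pow D_subset[OF one] by (simp add: principal subset_iff)
  also have "(cmod (\<Sum>x\<in>D 1. 1))\<^sup>2 = (real k)\<^sup>2" using card_D[OF one] by simp
  also have "real (card (characters ?K - {principal_character ?K})) = real (card H) - 1"
    using K.finite_characters[OF finK] K.principal_character_in_characters K.card_characters[OF finK]
      \<open>card H > 0\<close> by (simp add: ordK of_nat_diff Suc_leI)
  also have "(\<Sum>\<psi>\<in>characters ?K. (cmod (\<Sum>x\<in>D 1. \<psi> (x [^] w)))\<^sup>2) = real (card H) * real E"
    using K.sum_characters_norm_square[OF finK finite_D[OF one], of "\<lambda>x. x [^] w"] pow D_subset[OF one]
    by (auto simp: ordK E_def)
  finally have "real_of_int ((int k)\<^sup>2 + (int (card H) - 1) * int l) = real_of_int (int (card H) * int E)"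
    by simp
  then have eq: "(int k)\<^sup>2 + (int (card H) - 1) * int l = int (card H) * int E"
    by (simp only: of_int_eq_iff)
  have "card ((\<lambda>x. (x, x)) ` D 1) \<le> E"
    unfolding E_def using finite_D[OF one]
    by (intro card_mono) (auto intro: finite_subset[of _ "D 1 \<times> D 1"])
  then have "k \<le> E" using card_D[OF one] by (simp add: card_image inj_on_def)
  with eq show "\<exists>r::int. r \<ge> int k \<and> (int k)\<^sup>2 + (int (card H) - 1) * int l = int (card H) * r"
    by (intro exI[of _ "int E"]) simp
qed

text \<open>The first claim is (2a). The second yields (2b) for c = a - b and (2c) for c = a + b,
  each from a component with \<chi>(D_j) = c/(2a) \<chi>(D).\<close>

lemma nonvanishing_alternative:
  assumes p: "Factorial_Ring.prime p"
    and \<chi>: "\<chi> \<in> characters G" "\<chi> \<noteq> principal_character G" "(\<Sum>x\<in>U. \<chi> x) \<noteq> 0"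
    and e: "\<And>x. x \<in> carrier G \<Longrightarrow> \<chi> x ^ (p ^ e) = 1"
  shows "\<exists>r::int. r \<ge> int (k * m) \<and> (real (k * m))\<^sup>2 + (real p - 1) * N = real p * of_int r"
    and "c \<in> {a + b, a - b} \<Longrightarrow> \<exists>r::int. r \<ge> int k \<and>
      (real k)\<^sup>2 + (real p - 1) * ((of_int c)\<^sup>2 / (4 * (of_int a)\<^sup>2) * N) = real p * of_int r"
proof -
  \<comment> \<open>Minimality makes \<open>p ^ e'\<close> the exact order of \<chi>, so some value
    of \<chi> is a primitive root of unity of that order; \<open>e'\<close> is positive because
    \<chi> is not principal.\<close>
  define e' where "e' = (LEAST e. \<forall>x\<in>carrier G. \<chi> x ^ (p ^ e) = 1)"
  have e': "\<forall>x\<in>carrier G. \<chi> x ^ (p ^ e') = 1"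
    unfolding e'_def by (rule LeastI[of _ e]) (use e in blast)
  have "e' \<noteq> 0" using e' character_eq_principal_iff[OF \<chi>(1)] \<chi>(2) by auto
  then obtain n where n: "e' = Suc n" using not0_implies_Suc by blast
  then have "\<not> (\<forall>x\<in>carrier G. \<chi> x ^ (p ^ n) = 1)"
    using not_less_Least[of n "\<lambda>e. \<forall>x\<in>carrier G. \<chi> x ^ (p ^ e) = 1"] by (simp add: e'_def)
  then obtain g where g: "g \<in> carrier G" "\<chi> g ^ (p ^ n) \<noteq> 1" by blast
  have root: "\<chi> x ^ (p ^ Suc n) = 1" if "x \<in> carrier G" for x using e' that n by blast
  interpret R: prime_power_root p n "\<chi> g"
    using p root[OF g(1)] g(2) by unfold_locales
  have rootU: "\<chi> x ^ (p ^ Suc n) = 1" if "x \<in> U" for x using root U_subset that by blast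
  have p1: "\<not> p dvd 1" using p by (auto dest: prime_gt_1_nat)
  define T where "T = (\<lambda>t::nat. \<lambda>x\<in>carrier G. \<chi> x ^ t)"
  have T: "T t \<in> characters G" for t
    unfolding T_def by (rule charactersI) (simp_all add: character_mult[OF \<chi>(1)] character_nonzero[OF \<chi>(1)] power_mult_distrib)
  have T_sum: "(\<Sum>x\<in>A. T t x) = (\<Sum>x\<in>A. \<chi> x ^ t)" if "A \<subseteq> carrier G" for A t
    using that by (intro sum.cong) (auto simp: T_def)
  have normU: "(cmod (\<Sum>x\<in>U. \<chi> x ^ t))\<^sup>2 = N" if t: "\<not> p dvd t" for t
  proof -
    interpret S: prime_power_root p n "\<chi> g ^ t" using t by (rule R.coprime_power)
    have "T t g \<noteq> 1" using S.primitive g(1) by (auto simp: T_def)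
    then have np: "T t \<noteq> principal_character G" using g(1) character_eq_principal_iff[OF T] by blast
    \<comment> \<open>Conjugation runs backwards here: vanishing for exponent \<open>t\<close> would
      give vanishing for exponent 1.\<close>
    have "(\<Sum>x\<in>U. \<chi> x ^ t) \<noteq> 0"
      using R.conjugate_sum_eq_0[of U \<chi> "\<lambda>_. 1" t 1] rootU t p1 \<chi>(3) by auto
    then show ?thesis using value_pair(3)[OF T np] T_sum[OF U_subset] by simp
  qed
  have N_rat: "N \<in> \<rat>" by (simp add: N_def)
  have "\<exists>r::int. r \<ge> int (card U) \<and> (real (card U))\<^sup>2 + (real p - 1) * N = real p * of_int r"
    by (rule R.constant_norm_square_quotient[OF finite_U rootU normU N_rat])
  then show "\<exists>r::int. r \<ge> int (k * m) \<and> (real (k * m))\<^sup>2 + (real p - 1) * N = real p * of_int r"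
    by (simp only: card_U)
  assume c: "c \<in> {a + b, a - b}"
  note a = value_pair(1)[OF \<chi>]
  obtain j where j: "j \<in> {1..m}" and eq: "of_int (2 * a) * (\<Sum>x\<in>D j. \<chi> x) = of_int c * (\<Sum>x\<in>U. \<chi> x)"
    using both_components_occur[OF \<chi> c] by blast
  \<comment> \<open>Coefficients over \<open>U\<close> that encode the relation 2a \<chi>(D_j) = c
    \<chi>(D) as a vanishing integer combination, so that it carries over to every conjugate power
    of \<chi>.\<close>
  define d where "d = (\<lambda>x. (if x \<in> D j then 2 * a else 0) - c)"
  have d: "(\<Sum>x\<in>U. of_int (d x) * \<chi> x ^ t)
      = of_int (2 * a) * (\<Sum>x\<in>D j. \<chi> x ^ t) - of_int c * (\<Sum>x\<in>U. \<chi> x ^ t)" for t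
  proof -
    have "(\<Sum>x\<in>U. of_int (d x) * \<chi> x ^ t)
        = (\<Sum>x\<in>U. if x \<in> D j then of_int (2 * a) * \<chi> x ^ t else 0) - of_int c * (\<Sum>x\<in>U. \<chi> x ^ t)"
      unfolding sum_distrib_left sum_subtractf[symmetric] d_def
      by (intro sum.cong) (auto simp: algebra_simps)
    also have "(\<Sum>x\<in>U. if x \<in> D j then of_int (2 * a) * \<chi> x ^ t else 0)
        = (\<Sum>x\<in>U \<inter> D j. of_int (2 * a) * \<chi> x ^ t)"
      using finite_U by (simp only: sum.inter_restrict)
    also have "U \<inter> D j = D j" using D_subset_U[OF j] by blast
    finally show ?thesis by (simp add: sum_distrib_left)
  qed
  have normD: "(cmod (\<Sum>x\<in>D j. \<chi> x ^ t))\<^sup>2 = (of_int c)\<^sup>2 / (4 * (of_int a)\<^sup>2) * N" if t: "\<not> p dvd t" for t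
  proof -
    have "(\<Sum>x\<in>U. of_int (d x) * \<chi> x ^ 1) = 0" unfolding d using eq by simp
    then have "(\<Sum>x\<in>U. of_int (d x) * \<chi> x ^ t) = 0"
      using R.conjugate_sum_eq_0[of U \<chi> d 1 t] rootU t p1 by blast
    then have "of_int (2 * a) * (\<Sum>x\<in>D j. \<chi> x ^ t) = of_int c * (\<Sum>x\<in>U. \<chi> x ^ t)"
      unfolding d by simp
    then have "(cmod (of_int (2 * a) * (\<Sum>x\<in>D j. \<chi> x ^ t)))\<^sup>2 = (cmod (of_int c * (\<Sum>x\<in>U. \<chi> x ^ t)))\<^sup>2"
      by (rule arg_cong)
    then have "4 * (of_int a)\<^sup>2 * (cmod (\<Sum>x\<in>D j. \<chi> x ^ t))\<^sup>2 = (of_int c)\<^sup>2 * N"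
      using normU[OF t] by (simp add: norm_mult power_mult_distrib)
    then show ?thesis using a by (simp add: field_simps)
  qed
  have "(of_int c)\<^sup>2 / (4 * (of_int a)\<^sup>2) * N \<in> \<rat>" using N_rat by simp
  from R.constant_norm_square_quotient[of "D j" \<chi>, OF finite_D[OF j] _ normD this] rootU D_subset_U[OF j]
  show "\<exists>r::int. r \<ge> int k \<and>
      (real k)\<^sup>2 + (real p - 1) * ((of_int c)\<^sup>2 / (4 * (of_int a)\<^sup>2) * N) = real p * of_int r"
    unfolding card_D[OF j] by blast
qed

end

theorem theorem5p9:
  fixes G :: "('a, 'b) monoid_scheme"
    and D :: "nat \<Rightarrow> 'a set" and Gp :: "'a set"
    and v m k l p :: nat and a b :: int
  assumes "comm_group G" and "finite (carrier G)"
    and "is_SEDF G v m k l D" and "k > 1" and "m > 2"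
    and "simple_character_value_property G m l D a b"
    and "Factorial_Ring.prime p" and "p dvd v"
    and "sylow_subgroup G p Gp"
  shows
    "(card Gp dvd k * m \<and>
      (\<exists>r1::int. r1 \<ge> int k \<and>
         (int k)\<^sup>2 + (int (card Gp) - 1) * int l = int (card Gp) * r1))
     \<or>
     ((\<exists>r2::int. r2 \<ge> int (k * m) \<and>
         (real k)\<^sup>2 * (real m)\<^sup>2
           + (real p - 1) * (4 * (real_of_int a)\<^sup>2 * real l / ((real_of_int b)\<^sup>2 - (real_of_int a)\<^sup>2))
         = real p * real_of_int r2) \<and>
      (\<exists>r3::int. r3 \<ge> int k \<and>
         (real k)\<^sup>2
           + (real p - 1) * ((real_of_int b - real_of_int a) * real l / (real_of_int b + real_of_int a))
         = real p * real_of_int r3) \<and>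
      (\<exists>r4::int.
         (real k)\<^sup>2
           + (real p - 1) * ((real_of_int b + real_of_int a) * real l / (real_of_int b - real_of_int a))
         = real p * real_of_int r4))"
proof -
  interpret simple_SEDF G v m k l D a b
    using assms by (simp add: simple_SEDF_def simple_SEDF_axioms_def)
  define s where "s = multiplicity p v"
  have H: "subgroup Gp G" and card_H: "card Gp = p ^ s"
    using assms(9) by (simp_all add: sylow_subgroup_def s_def order_eq)
  have "v > 0" using fin order_gt_0_iff_finite order_eq by blast
  then obtain w where w: "v = p ^ s * w" "\<not> p dvd w"
    unfolding s_def using multiplicity_decompose'[of v p] assms(7)
    by (metis less_not_refl not_prime_unit)
  have cop: "coprime w (card Gp)"
    unfolding card_H using w(2) assms(7) by (simp add: prime_imp_coprime coprime_commute)
  have index: "w * card Gp = v" using w(1) card_H by simp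
  let ?K = "G\<lparr>carrier := Gp\<rparr>"
  \<comment> \<open>The characters of \<open>Gp\<close> composed with the \<open>w\<close>-th power
    map supply the characters of p-power order needed for the case split.\<close>
  show ?thesis
  proof (cases "\<forall>\<psi>\<in>characters ?K. \<psi> \<noteq> principal_character ?K \<longrightarrow> (\<Sum>x\<in>U. \<psi> (x [^]\<^bsub>G\<^esub> w)) = 0")
    case True
    with vanishing_alternative[OF H index cop] show ?thesis by blast
  next
    case False
    then obtain \<psi> where \<psi>: "\<psi> \<in> characters ?K" "\<psi> \<noteq> principal_character ?K"
      "(\<Sum>x\<in>U. \<psi> (x [^]\<^bsub>G\<^esub> w)) \<noteq> 0" by blast
    define \<chi> where "\<chi> = (\<lambda>x\<in>carrier G. \<psi> (x [^]\<^bsub>G\<^esub> w))"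
    have index': "w * card Gp = Coset.order G" using index order_eq by simp
    have "(\<Sum>x\<in>U. \<chi> x) = (\<Sum>x\<in>U. \<psi> (x [^]\<^bsub>G\<^esub> w))"
      using U_subset by (intro sum.cong) (auto simp: \<chi>_def)
    then have \<chi>: "\<chi> \<in> characters G" "\<chi> \<noteq> principal_character G" "(\<Sum>x\<in>U. \<chi> x) \<noteq> 0"
      using pullback_character(1,2)[OF H fin index' cop \<psi>(1)] \<psi>(2,3) by (simp_all add: \<chi>_def)
    have root: "\<chi> x ^ (p ^ s) = 1" if "x \<in> carrier G" for x
      using pullback_character(3)[OF H fin index' cop \<psi>(1) that] that by (simp add: \<chi>_def card_H)
    note ab = value_pair(1,2)[OF \<chi>]
    \<comment> \<open>Cancelling one factor of b^2 - a^2 = (b - a)(b + a) turns the component norms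
      into the fractions of (2b) and (2c).\<close>
    have "(real_of_int a - real_of_int b)\<^sup>2 / (4 * (real_of_int a)\<^sup>2) * N
        = (real_of_int b - real_of_int a) * real l / (real_of_int b + real_of_int a)"
      using ab by (simp add: N_def square_diff_square_factored divide_simps) (simp add: power2_eq_square algebra_simps)
    moreover have "(real_of_int a + real_of_int b)\<^sup>2 / (4 * (real_of_int a)\<^sup>2) * N
        = (real_of_int b + real_of_int a) * real l / (real_of_int b - real_of_int a)"
      using ab by (simp add: N_def square_diff_square_factored divide_simps) (simp add: power2_eq_square algebra_simps)
    ultimately show ?thesis
      using nonvanishing_alternative(1)[OF assms(7) \<chi> root]
        nonvanishing_alternative(2)[OF assms(7) \<chi> root, of "a - b"]
        nonvanishing_alternative(2)[OF assms(7) \<chi> root, of "a + b"]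
      by (auto simp: N_def power_mult_distrib)
  qed
qed

end
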